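(* Let $N\ge 2$ be an integer and let $L$ be a scalar constant coefficient operator with Fourier symbol $\widehat L(k)=-k^{2N}$, so that the equation $u_{tt}=L[u]$ has the monomial dispersion relation $\omega(k)=\pm k^N$. Suppose that $f$ and $g$ are of bounded variation and that $\int_0^{2\pi}g(x)\,dx=0$. Let $G(x)=\partial_x^{-N}g(x)$. Then at each rational time $t^\ast=\pi p/q$ ($p,q$ positive integers with no common factors), the solution of $u_{tt}=L[u]$ on $0\le x\le 2\pi$ with periodic boundary conditions and initial conditions $u(0,x)=f(x)$, $u_t(0,x)=g(x)$ takes the form $$u(t^\ast,x)=\sum_{j=0}^{2q-1}a_j\left(\frac pq\right)f\left(x-\frac{\pi j}{q}\right)+\mathrm{i}^N\sum_{j=0}^{2q-1}b_j\left(\frac pq\right)G\left(x-\frac{\pi j}{q}\right)+\sum_{j=0}^{N-1}C_jx^j,$$ $$C_j=\frac{\mathrm{i}^j}{j!}\sum_{k\ne0}\frac{\widehat g(k)\sin(k^Nt^\ast)}{k^{N-j}},$$ where the coefficients $a_j,b_j\in\mathbb{C}$, $j=0,\dots,2q-1$, are constants depending on $p$ and $q$.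
   Context: Functions defined on $[0,2\pi]$ are extended $2\pi$-periodically to $\mathbb{R}$ when required. Fourier coefficients are $\widehat h(k)=\frac1{2\pi}\int_0^{2\pi}h(x)e^{-\mathrm{i}kx}\,dx$, $k\in\mathbb{Z}$. The operator $\partial_x^{-1}$ is defined by $\partial_x^{-1}P(x)=\int_{2(k-1)\pi}^xP(y)\,dy$ for $x\in[2(k-1)\pi,2k\pi]$, and its powers by $\partial_x^{-M}=\partial_x^{-1}\partial_x^{-(M-1)}$ for $M\ge1$. The solution of the periodic initial-boundary value problem is given by the Fourier series $$u(t,x)=\sum_{k}\widehat f(k)\cos(k^Nt)e^{\mathrm{i}kx}+\sum_{k\neq0}\frac{\widehat g(k)\sin(k^Nt)}{k^N}e^{\mathrm{i}kx}.$$
   Formalization: G(x−πj/q) is replaced by ∂_x^{-N} applied to g(·−πj/q), as the literal shift of G fails (N=2, t*=π/2, f=0, g=cos x+cos 4x); equality is convergence of symmetric sums off a countable set, and at each x where f equals the mean of its one-sided limits at all x−πj/q. *)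

theory Defs
  imports "HOL-Analysis.Analysis" "HOL-Library.Real_Mod"
begin

definition bounded_variation_on :: "real \<Rightarrow> real \<Rightarrow> (real \<Rightarrow> complex) \<Rightarrow> bool" where
  "bounded_variation_on a b h \<longleftrightarrow>
     (\<exists>B. \<forall>(n::nat) (s::nat \<Rightarrow> real).
        (\<forall>i\<le>n. s i \<in> {a..b}) \<and> (\<forall>i<n. s i \<le> s (Suc i)) \<longrightarrow>
        (\<Sum>i<n. norm (h (s (Suc i)) - h (s i))) \<le> B)"

text \<open>The extension uses the values on \<open>[0, 2\<pi>)\<close>; the value at \<open>2\<pi>\<close> is discarded.\<close>

definition periodic_ext :: "(real \<Rightarrow> complex) \<Rightarrow> real \<Rightarrow> complex" where
  "periodic_ext h x = h (x rmod (2 * pi))"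

definition fourier_coeff :: "(real \<Rightarrow> complex) \<Rightarrow> int \<Rightarrow> complex" where
  "fourier_coeff h k =
     1 / (2 * of_real pi) * integral {0..2*pi} (\<lambda>x. h x * exp (- \<i> * of_int k * of_real x))"

text \<open>
  The operator \<open>\<partial>\<^sub>x\<^sup>-\<^sup>1\<close> on the cell \<open>[2(k-1)\<pi>, 2k\<pi>]\<close>. Adjacent cells share an endpoint, at which
  the two integrals may differ, so the cell index is kept as an argument. On the cell, the power
  \<open>\<partial>\<^sub>x\<^sup>-\<^sup>M\<close> is \<open>dx_inv k ^^ M\<close>, as only values on the cell enter.
\<close>

definition dx_inv :: "int \<Rightarrow> (real \<Rightarrow> complex) \<Rightarrow> real \<Rightarrow> complex" where
  "dx_inv k P x = integral {2 * (of_int k - 1) * pi..x} P"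

text \<open>
  The \<open>k\<close>-th Fourier coefficient of the solution at time \<open>t\<close>. The series for discontinuous \<open>f\<close> is in
  general only conditionally convergent; it is summed symmetrically.
\<close>

definition solution_mode ::
  "nat \<Rightarrow> (real \<Rightarrow> complex) \<Rightarrow> (real \<Rightarrow> complex) \<Rightarrow> int \<Rightarrow> real \<Rightarrow> complex" where
  "solution_mode N f g k t =
     fourier_coeff f k * of_real (cos (of_int k ^ N * t)) +
     (if k = 0 then 0
      else fourier_coeff g k * of_real (sin (of_int k ^ N * t)) / of_int k ^ N)"

definition solution_partial_sum ::
  "nat \<Rightarrow> (real \<Rightarrow> complex) \<Rightarrow> (real \<Rightarrow> complex) \<Rightarrow> real \<Rightarrow> real \<Rightarrow> nat \<Rightarrow> complex" where
  "solution_partial_sum N f g t x n =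
     (\<Sum>k\<in>{- int n..int n}. solution_mode N f g k t * exp (\<i> * of_int k * of_real x))"

definition L_symbol :: "nat \<Rightarrow> int \<Rightarrow> complex" where
  "L_symbol N k = - (of_int k ^ (2 * N))"

text \<open>
  The series solves \<open>u\<^sub>t\<^sub>t = L[u]\<close>, \<open>u(0,\<cdot>) = f\<close>, \<open>u\<^sub>t(0,\<cdot>) = g\<close> mode by mode. Mean zero of \<open>g\<close> removes
  the secular term of the mode \<open>k = 0\<close>.
\<close>

lemma solution_mode_ivp:
  assumes mean: "integral {0..2*pi} g = 0"
  shows "\<exists>V. solution_mode N f g k 0 = fourier_coeff f k \<and> V 0 = fourier_coeff g k \<and>
           (\<forall>t. (solution_mode N f g k has_vector_derivative V t) (at t) \<and>
                (V has_vector_derivative L_symbol N k * solution_mode N f g k t) (at t))"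
proof -
  define w :: real where "w = of_int k ^ N"
  have w: "of_int k ^ N = complex_of_real w" by (simp add: w_def)
  have L: "L_symbol N k = - (complex_of_real w)\<^sup>2"
    by (simp add: L_symbol_def w power_mult power_mult_distrib mult.commute[of 2] power_even_eq)
  define F where "F = fourier_coeff f k"
  define H where "H = fourier_coeff g k"
  define V where "V = (\<lambda>t. - F * of_real w * of_real (sin (w * t)) + H * of_real (cos (w * t)))"
  have H0: "k = 0 \<Longrightarrow> H = 0"
    using mean by (simp add: H_def fourier_coeff_def)
  have U: "solution_mode N f g k =
      (\<lambda>t. F * of_real (cos (w * t)) + H * of_real (sin (w * t)) / of_real w)"
    using H0 by (auto simp: fun_eq_iff solution_mode_def F_def H_def w_def)
  have c: "((\<lambda>t. complex_of_real (cos (w * t))) has_vector_derivative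
             of_real (- w * sin (w * t))) (at t)" for t
    by (rule has_vector_derivative_of_real) (auto intro!: derivative_eq_intros)
  have s: "((\<lambda>t. complex_of_real (sin (w * t))) has_vector_derivative
             of_real (w * cos (w * t))) (at t)" for t
    by (rule has_vector_derivative_of_real) (auto intro!: derivative_eq_intros)
  have w0: "w = 0 \<Longrightarrow> H = 0"
    using H0 by (auto simp: w_def)
  have d1: "(solution_mode N f g k has_vector_derivative V t) (at t)" for t
  proof -
    have "((\<lambda>t. F * of_real (cos (w * t)) + H / of_real w * of_real (sin (w * t)))
        has_vector_derivative
          F * of_real (- w * sin (w * t)) + H / of_real w * of_real (w * cos (w * t))) (at t)"
      by (intro has_vector_derivative_add has_vector_derivative_mult_right c s)
    moreover have "F * of_real (- w * sin (w * t)) + H / of_real w * of_real (w * cos (w * t)) = V t"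
      using w0 by (cases "w = 0") (auto simp: V_def)
    ultimately show ?thesis by (simp add: U)
  qed
  have d2: "(V has_vector_derivative L_symbol N k * solution_mode N f g k t) (at t)" for t
  proof -
    have "(V has_vector_derivative
        (- F * of_real w) * of_real (w * cos (w * t)) + H * of_real (- w * sin (w * t))) (at t)"
      unfolding V_def
      by (intro has_vector_derivative_add has_vector_derivative_mult_right c s)
    moreover have "(- F * of_real w) * of_real (w * cos (w * t)) + H * of_real (- w * sin (w * t))
        = L_symbol N k * solution_mode N f g k t"
      using w0 by (cases "w = 0") (auto simp: U L field_simps power2_eq_square)
    ultimately show ?thesis by simp
  qed
  have "solution_mode N f g k 0 = F" "V 0 = H"
    by (simp_all add: U V_def)
  with d1 d2 show ?thesis unfolding F_def H_def by blast
qed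

definition poly_coeff :: "nat \<Rightarrow> (real \<Rightarrow> complex) \<Rightarrow> real \<Rightarrow> nat \<Rightarrow> complex" where
  "poly_coeff N g t j =
     \<i> ^ j / fact j *
     (\<Sum>\<^sub>\<infinity>k\<in>UNIV - {0::int}.
        fourier_coeff g k * of_real (sin (of_int k ^ N * t)) / of_int k ^ (N - j))"

text \<open>
  \<open>G(x - s)\<close> for \<open>G(x) = \<partial>\<^sub>x\<^sup>-\<^sup>N g(x)\<close> and \<open>x \<in> [0, 2\<pi>]\<close>, read as \<open>\<partial>\<^sub>x\<^sup>-\<^sup>N\<close> applied to the function
  \<open>x \<mapsto> g(x - s)\<close>. Composing \<open>\<partial>\<^sub>x\<^sup>-\<^sup>N g\<close> with the shift instead gives another function, as \<open>\<partial>\<^sub>x\<^sup>-\<^sup>1\<close>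
  does not commute with translations. The formulas for \<open>C\<^sub>j\<close> require the present
  reading: they are the Taylor coefficients of the \<open>g\<close>-part of the solution at \<open>x = 0\<close>, where
  \<open>\<partial>\<^sub>x\<^sup>-\<^sup>N\<close> of any function vanishes together with its iterated primitives of lower order. With the
  composition the claim fails for \<open>N = 2\<close>, \<open>t = \<pi>/2\<close>, \<open>f = 0\<close>, \<open>g(x) = cos x + cos 4x\<close>.
\<close>

definition G_shift :: "nat \<Rightarrow> (real \<Rightarrow> complex) \<Rightarrow> real \<Rightarrow> real \<Rightarrow> complex" where
  "G_shift N g s x = (dx_inv 1 ^^ N) (\<lambda>y. periodic_ext g (y - s)) x"

text \<open>
  The Fourier series of a function of bounded variation converges at each point to the mean of
  the one-sided limits, so pointwise identities hold where the value is that mean: at all points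
  of continuity, and at jumps with the normalised value.
\<close>

definition mean_value_at :: "(real \<Rightarrow> complex) \<Rightarrow> real \<Rightarrow> bool" where
  "mean_value_at F y \<longleftrightarrow> ((\<lambda>h. (F (y + h) + F (y - h)) / 2) \<longlongrightarrow> F y) (at_right 0)"

end

theory Submission
  imports Defs
begin

text \<open>
  At \<open>t = \<pi> p / q\<close> the multipliers \<open>cos (k\<^sup>N t)\<close> and \<open>sin (k\<^sup>N t)\<close> are \<open>2q\<close>-periodic in \<open>k\<close>, so the
  discrete Fourier transform writes them as combinations of \<open>exp (-\<i> k \<pi> j / q)\<close>, that is, of
  translations by \<open>\<pi> j / q\<close>. For the \<open>f\<close>-part this reduces the claim to convergence of the
  Fourier series of \<open>f\<close>: Fejer's theorem gives it in the Cesaro sense wherever \<open>f\<close> takes its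
  mean value, and Hardy's Tauberian theorem applies because the coefficients are \<open>O(1/k)\<close> by bounded
  variation. For the \<open>g\<close>-part, the partial sums are uniformly bounded and converge off a
  countable set, so dominated convergence permits termwise \<open>N\<close>-fold integration from \<open>0\<close>. Each
  integration subtracts the value at \<open>0\<close>, turning \<open>exp (\<i> k x)\<close> into its Taylor remainder of order
  \<open>N\<close> divided by \<open>(\<i> k)\<^sup>N\<close>; the subtracted Taylor terms sum to the polynomial with coefficients \<open>C\<^sub>j\<close>.
\<close>

subsection \<open>Cesaro means and Hardy's Tauberian theorem\<close>

text \<open>Each of the \<open>j\<close> increments after index \<open>n\<close> is at most
  \<open>C / real (Suc n)\<close>, because the denominators grow; the triangle inequality adds them
  up.\<close>

lemma norm_diff_le_of_step:
  fixes S :: "nat \<Rightarrow> 'a::real_normed_vector"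
  assumes step: "\<And>n. norm (S (Suc n) - S n) \<le> C / real (Suc n)"
  shows "norm (S (n + j) - S n) \<le> C * real j / real (Suc n)"
proof (induction j)
  case (Suc j)
  have "0 \<le> C"
    using order_trans[OF norm_ge_zero step[of 0]] by simp
  have "norm (S (n + Suc j) - S n) \<le> norm (S (Suc (n + j)) - S (n + j)) + norm (S (n + j) - S n)"
    using norm_triangle_ineq[of "S (Suc (n + j)) - S (n + j)" "S (n + j) - S n"] by simp
  also have "\<dots> \<le> C / real (Suc (n + j)) + C * real j / real (Suc n)"
    by (intro add_mono step Suc)
  also have "C / real (Suc (n + j)) \<le> C / real (Suc n)"
    using \<open>0 \<le> C\<close> by (intro divide_left_mono) auto
  also have "C / real (Suc n) + C * real j / real (Suc n) = C * real (Suc j) / real (Suc n)"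
    by (simp add: add_divide_distrib[symmetric] algebra_simps)
  finally show ?case by simp
qed simp

text \<open>Abel summation: \<open>Suc n\<close> times \<open>S n\<close> minus the sum of the
  \<open>S m\<close> is the sum over \<open>m < n\<close> of the increments weighted by
  \<open>Suc m\<close>, each of norm at most \<open>C\<close>. Hence partial sums are bounded as
  soon as their Cesaro means are.\<close>

lemma norm_diff_cesaro_le:
  fixes S :: "nat \<Rightarrow> 'a::real_normed_vector"
  assumes step: "\<And>n. norm (S (Suc n) - S n) \<le> C / real (Suc n)"
  shows "norm (S n - (\<Sum>m\<le>n. S m) /\<^sub>R real (Suc n)) \<le> C"
proof -
  have "0 \<le> C"
    using order_trans[OF norm_ge_zero step[of 0]] by simp
  have *: "norm (real (Suc n) *\<^sub>R S n - (\<Sum>m\<le>n. S m)) \<le> C * real n" for n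
  proof (induction n)
    case (Suc n)
    have "real (Suc (Suc n)) *\<^sub>R S (Suc n) - (\<Sum>m\<le>Suc n. S m)
        = real (Suc n) *\<^sub>R (S (Suc n) - S n) + (real (Suc n) *\<^sub>R S n - (\<Sum>m\<le>n. S m))"
      by (simp add: algebra_simps scaleR_2)
    also have "norm \<dots> \<le> real (Suc n) * norm (S (Suc n) - S n) + C * real n"
      by (intro order_trans[OF norm_triangle_ineq] add_mono Suc) simp
    also have "real (Suc n) * norm (S (Suc n) - S n) \<le> C"
      using mult_left_mono[OF step[of n], of "real (Suc n)"] by simp
    finally show ?case by (simp add: algebra_simps)
  qed simp
  have "S n - (\<Sum>m\<le>n. S m) /\<^sub>R real (Suc n)
      = (real (Suc n) *\<^sub>R S n - (\<Sum>m\<le>n. S m)) /\<^sub>R real (Suc n)"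
    by (simp add: scaleR_diff_right del: of_nat_Suc)
  also have "norm \<dots> \<le> C * real n / real (Suc n)"
    using divide_right_mono[OF *[of n], of "real (Suc n)"] by (simp add: divide_inverse mult.commute del: of_nat_Suc)
  also have "\<dots> \<le> C"
    using \<open>0 \<le> C\<close> by (simp add: field_simps)
  finally show ?thesis .
qed

text \<open>\<open>S n\<close> is compared with its average over the next \<open>d\<close> indices,
  \<open>d\<close> about \<open>\<epsilon> * Suc n\<close>. The block sum of \<open>S - L\<close> is
  \<open>T (n + d) - T n\<close>, small against \<open>d\<close> by Cesaro convergence, while the
  step condition keeps \<open>S\<close> within \<open>C * (2 * \<epsilon>)\<close> of
  \<open>S n\<close> on the block.\<close>

lemma hardy_tauberian:
  fixes S :: "nat \<Rightarrow> 'a::real_normed_vector"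
  assumes step: "\<And>n. norm (S (Suc n) - S n) \<le> C / real (Suc n)"
    and cesaro: "(\<lambda>n. (\<Sum>m\<le>n. S m) /\<^sub>R real (Suc n)) \<longlonglongrightarrow> L"
  shows "S \<longlonglongrightarrow> L"
proof (rule LIMSEQ_I)
  fix r :: real assume "0 < r"
  have "0 \<le> C"
    using order_trans[OF norm_ge_zero step[of 0]] by simp
  define T where "T n = (\<Sum>m\<le>n. S m - L)" for n
  \<comment> \<open>\<open>\<epsilon>\<close> keeps the oscillation on a block below
    \<open>r / 2\<close>, with \<open>C + 1\<close> excluding a zero denominator;
    \<open>\<delta>\<close> solves \<open>\<delta> * (2 / \<epsilon> + 1) = r / 4\<close>, the share
    of the Cesaro error.\<close>
  define \<epsilon> where "\<epsilon> = r / (4 * (C + 1))"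
  define \<delta> where "\<delta> = r / 4 / (2 / \<epsilon> + 1)"
  have "0 < \<epsilon>" using \<open>0 < r\<close> \<open>0 \<le> C\<close> by (simp add: \<epsilon>_def)
  then have "0 < 2 / \<epsilon> + 1" by (simp add: add_pos_pos)
  then have "0 < \<delta>" using \<open>0 < r\<close> by (simp add: \<delta>_def)
  obtain n0 where n0: "\<And>n. n \<ge> n0 \<Longrightarrow> norm ((\<Sum>m\<le>n. S m) /\<^sub>R real (Suc n) - L) < \<delta>"
    using LIMSEQ_D[OF cesaro \<open>0 < \<delta>\<close>] by blast
  have T: "norm (T n) \<le> \<delta> * real (Suc n)" if "n \<ge> n0" for n
  proof -
    have "T n = real (Suc n) *\<^sub>R ((\<Sum>m\<le>n. S m) /\<^sub>R real (Suc n) - L)"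
      by (simp add: T_def sum_subtractf scaleR_diff_right scaleR_conv_of_real sum_constant_scaleR del: of_nat_Suc)
    then have "norm (T n) = real (Suc n) * norm ((\<Sum>m\<le>n. S m) /\<^sub>R real (Suc n) - L)"
      by simp
    also have "\<dots> \<le> real (Suc n) * \<delta>"
      using n0[OF that] by (intro mult_left_mono) auto
    finally show ?thesis by (simp add: mult.commute)
  qed
  show "\<exists>n0. \<forall>n\<ge>n0. norm (S n - L) < r"
  proof (intro exI allI impI)
    fix n assume n: "max n0 (nat \<lceil>1 / \<epsilon>\<rceil>) \<le> n"
    define a where "a = real (Suc n)"
    have "1 / \<epsilon> \<le> a" using n by (simp add: a_def)
    then have a: "1 \<le> \<epsilon> * a" using \<open>0 < \<epsilon>\<close> by (simp add: field_simps)
    have "0 < a" by (simp add: a_def)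
    \<comment> \<open>Since \<open>1 \<le> \<epsilon> * a\<close>, rounding up at most doubles
      \<open>\<epsilon> * a\<close>.\<close>
    define d where "d = nat \<lceil>\<epsilon> * a\<rceil>"
    have d: "\<epsilon> * a \<le> real d" "real d \<le> 2 * (\<epsilon> * a)" "0 < real d"
      using a unfolding d_def by linarith+
    have "T (n + d) = T n + (\<Sum>j\<in>{1..d}. S (n + j) - L)"
    proof (induction d)
      case (Suc d)
      then show ?case by (simp add: T_def)
    qed simp
    then have eq: "real d *\<^sub>R (S n - L) = T (n + d) - T n - (\<Sum>j\<in>{1..d}. S (n + j) - S n)"
      by (simp add: sum_subtractf algebra_simps sum_constant_scaleR)
    have "norm (\<Sum>j\<in>{1..d}. S (n + j) - S n) \<le> (\<Sum>j\<in>{1..d}. C * real d / a)"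
    proof (rule sum_norm_le)
      fix j assume "j \<in> {1..d}"
      have "norm (S (n + j) - S n) \<le> C * real j / a"
        unfolding a_def by (rule norm_diff_le_of_step[OF step])
      also have "\<dots> \<le> C * real d / a"
        using \<open>j \<in> {1..d}\<close> \<open>0 \<le> C\<close> \<open>0 < a\<close> by (intro divide_right_mono mult_left_mono) auto
      finally show "norm (S (n + j) - S n) \<le> C * real d / a" .
    qed
    also have "\<dots> = real d * (C * (real d / a))" by simp
    also have "\<dots> \<le> real d * (C * (2 * \<epsilon>))"
      using d \<open>0 \<le> C\<close> \<open>0 < a\<close> by (intro mult_left_mono) (auto simp: field_simps)
    finally have 1: "norm (\<Sum>j\<in>{1..d}. S (n + j) - S n) \<le> real d * (C * (2 * \<epsilon>))" .
    have "norm (T (n + d)) + norm (T n) \<le> \<delta> * (a + real d) + \<delta> * a"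
      using T[of "n + d"] T[of n] n by (simp add: a_def algebra_simps)
    also have "\<dots> = \<delta> * (2 * a + real d)" by (simp add: algebra_simps)
    also have "\<dots> \<le> \<delta> * (real d * (2 / \<epsilon> + 1))"
      using d \<open>0 < \<delta>\<close> \<open>0 < \<epsilon>\<close> by (intro mult_left_mono) (auto simp: field_simps)
    also have "\<dots> = real d * (r / 4)"
    proof -
      have "\<delta> * (2 / \<epsilon> + 1) = r / 4"
        using \<open>0 < 2 / \<epsilon> + 1\<close> unfolding \<delta>_def by (intro nonzero_eq_divide_eq[THEN iffD1]) auto
      then show ?thesis by (metis mult.left_commute)
    qed
    finally have 2: "norm (T (n + d)) + norm (T n) \<le> real d * (r / 4)" .
    have "real d * norm (S n - L) = norm (T (n + d) - T n - (\<Sum>j\<in>{1..d}. S (n + j) - S n))"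
      by (metis eq norm_scaleR abs_of_nat)
    also have "\<dots> \<le> norm (T (n + d)) + norm (T n) + norm (\<Sum>j\<in>{1..d}. S (n + j) - S n)"
      by (smt (verit) norm_triangle_ineq4)
    also have "\<dots> \<le> real d * (r / 4 + C * (2 * \<epsilon>))"
      using 1 2 by (simp add: algebra_simps)
    finally have "norm (S n - L) \<le> r / 4 + C * (2 * \<epsilon>)"
      using d by simp
    also have "C * (2 * \<epsilon>) \<le> r / 2"
      using \<open>0 \<le> C\<close> \<open>0 < r\<close> by (simp add: \<epsilon>_def field_simps)
    finally show "norm (S n - L) < r" using \<open>0 < r\<close> by simp
  qed
qed

text \<open>Split \<open>{a..b + p}\<close> once at \<open>a + p\<close> and once at
  \<open>b\<close>: the leftover pieces \<open>{a + p..b + p}\<close> and \<open>{a..b}\<close>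
  carry the same integral by periodicity.\<close>

lemma integral_shift_period:
  fixes F :: "real \<Rightarrow> 'a::banach"
  assumes per: "\<And>x. F (x + p) = F x" and int: "\<And>a b. F integrable_on {a..b}" and "p \<ge> 0"
  shows "integral {a..a + p} F = integral {b..b + p} F"
proof -
  have *: "integral {a..a + p} F = integral {b..b + p} F" if "a \<le> b" for a b
  proof -
    have "integral {a..a + p} F + integral {a + p..b + p} F = integral {a..b} F + integral {b..b + p} F"
      using that \<open>p \<ge> 0\<close> Henstock_Kurzweil_Integration.integral_combine[OF _ _ int, of a "a + p" "b + p"]
        Henstock_Kurzweil_Integration.integral_combine[OF _ _ int, of a b "b + p"] by simp
    moreover have "integral {a + p..b + p} F = integral {a..b} F"
      using integral_shift_real_ivl[of "a + p" p "b + p" F] by (simp add: per)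
    ultimately show ?thesis by simp
  qed
  show ?thesis
    by (metis * linear)
qed

subsection \<open>Fourier coefficients of periodic functions of bounded variation\<close>

lemma fourier_coeff_cis:
  "fourier_coeff F k = integral {0..2*pi} (\<lambda>x. F x * cis (- (of_int k * x))) / (2 * of_real pi)"
proof -
  have "exp (- \<i> * of_int k * of_real x) = cis (- (of_int k * x))" for x
    by (simp add: cis_conv_exp mult.assoc)
  then show ?thesis by (simp add: fourier_coeff_def)
qed

definition fourier_sum :: "(real \<Rightarrow> complex) \<Rightarrow> nat \<Rightarrow> real \<Rightarrow> complex" where
  "fourier_sum F n y = (\<Sum>k\<in>{- int n..int n}. fourier_coeff F k * cis (of_int k * y))"

text \<open>Bounded variation is encoded by a function \<open>W\<close> on the whole line whose
  increments dominate those of \<open>F\<close>; the variation function is the model. Questions on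
  \<open>F\<close> then become questions on a monotone function, free of partitions.
  \<open>W\<close> may climb from period to period.\<close>

locale periodic_bv =
  fixes F :: "real \<Rightarrow> complex" and W :: "real \<Rightarrow> real"
  assumes periodic: "F (x + 2 * pi) = F x"
    and var_le: "x \<le> y \<Longrightarrow> norm (F y - F x) \<le> W y - W x"
begin

lemma mono_W: "mono W"
proof (rule monoI)
  show "W x \<le> W y" if "x \<le> y" for x y
    using order_trans[OF norm_ge_zero var_le[OF that]] by simp
qed

lemma translate: "periodic_bv (\<lambda>x. F (x - s)) (\<lambda>x. W (x - s))"
proof
  show "F (x + 2 * pi - s) = F (x - s)" for x
    using periodic[of "x - s"] by (simp add: algebra_simps)
qed (auto intro: var_le)

lemma periodic_int: "F (x + of_int m * (2 * pi)) = F x"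
proof (induction m rule: int_induct[where k = 0])
  case (step1 i)
  then show ?case using periodic[of "x + of_int i * (2 * pi)"] by (simp add: algebra_simps)
next
  case (step2 i)
  then show ?case using periodic[of "x + of_int (i - 1) * (2 * pi)"] by (simp add: algebra_simps)
qed simp

lemma periodic_rmod: "F (x rmod (2 * pi)) = F x"
  using periodic_int[of x "- \<lfloor>x / (2 * pi)\<rfloor>"] by (simp add: rmod_def algebra_simps)

definition bound :: real where "bound = norm (F 0) + (W (2 * pi) - W 0)"

lemma norm_le_bound: "norm (F x) \<le> bound"
proof -
  define z where "z = x rmod (2 * pi)"
  have z: "0 \<le> z" "z \<le> 2 * pi"
    using rmod_nonneg[of "2 * pi" x] rmod_le[of "2 * pi" x] by (auto simp: z_def)
  have "norm (F z) \<le> norm (F 0) + norm (F z - F 0)"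
    using norm_triangle_ineq[of "F 0" "F z - F 0"] by simp
  also have "norm (F z - F 0) \<le> W z - W 0" using z by (intro var_le)
  also have "W z \<le> W (2 * pi)" using z mono_W by (auto dest: monoD)
  finally show ?thesis by (simp add: z_def periodic_rmod bound_def)
qed

lemma bound_nonneg: "0 \<le> bound"
  using order_trans[OF norm_ge_zero norm_le_bound] .

text \<open>The increments of \<open>F\<close> are squeezed by those of \<open>W\<close>, so
  \<open>F\<close> can be discontinuous only where the monotone \<open>W\<close> is, that is, at
  countably many points.\<close>

lemma isCont_if_isCont_W:
  assumes "isCont W x" shows "isCont F x"
proof -
  have "((\<lambda>y. F y - F x) \<longlongrightarrow> 0) (at x)"
  proof (rule Lim_null_comparison)
    show "\<forall>\<^sub>F y in at x. norm (F y - F x) \<le> \<bar>W y - W x\<bar>"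
    proof (rule always_eventually, rule allI)
      show "norm (F y - F x) \<le> \<bar>W y - W x\<bar>" for y
        using var_le[of x y] var_le[of y x] by (cases "x \<le> y") (auto simp: norm_minus_commute)
    qed
    show "((\<lambda>y. \<bar>W y - W x\<bar>) \<longlongrightarrow> 0) (at x)"
      using assms unfolding isCont_def by (auto intro!: tendsto_eq_intros)
  qed
  then show ?thesis unfolding isCont_def by (simp add: LIM_zero_iff)
qed

lemma countable_discont: "countable {x. \<not> isCont F x}"
  by (rule countable_subset[OF _ mono_ctble_discont[OF mono_W]]) (use isCont_if_isCont_W in auto)

lemma borel_measurable: "F \<in> borel_measurable borel"
proof (rule borel_measurable_continuous_countable_exceptions[OF countable_discont])
  show "continuous_on (- {x. \<not> isCont F x}) F"
    by (rule continuous_at_imp_continuous_on) auto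
qed

lemma integrable_mult:
  assumes "continuous_on UNIV c"
  shows "(\<lambda>x. F x * c x) integrable_on {a..b}"
proof (rule measurable_bounded_by_integrable_imp_integrable)
  have c: "c \<in> borel_measurable borel"
    using assms by (rule borel_measurable_continuous_onI)
  then have "(\<lambda>x. F x * c x) \<in> borel_measurable borel"
    using borel_measurable by simp
  then show "(\<lambda>x. F x * c x) \<in> borel_measurable (lebesgue_on {a..b})"
    by (intro measurable_restrict_space1 measurable_completion) simp
  show "(\<lambda>x. bound * norm (c x)) integrable_on {a..b}"
    by (intro integrable_continuous_real continuous_intros continuous_on_subset[OF assms]) auto
  show "norm (F x * c x) \<le> bound * norm (c x)" for x
    by (simp add: norm_mult norm_le_bound mult_right_mono)
qed auto

lemma W_integrable: "W integrable_on {a..b}"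
  by (rule integrable_on_mono_on[OF mono_imp_mono_on[OF mono_W]])

text \<open>After the shift, the integrals of \<open>W\<close> over the common part cancel, leaving
  \<open>{2*pi..2*pi + h}\<close> against \<open>{0..h}\<close>. Monotonicity bounds both by extreme
  values; \<open>h \<le> 2 * pi\<close> is what makes \<open>W (4 * pi)\<close> suffice.\<close>

lemma integral_variation_le:
  assumes "0 \<le> h" "h \<le> 2 * pi"
  shows "integral {0..2*pi} (\<lambda>x. W (x + h) - W x) \<le> h * (W (4 * pi) - W 0)"
proof -
  have s: "integral {0..2*pi} (\<lambda>x. W (x + h)) = integral {h..2*pi + h} W"
    using integral_shift_real_ivl[of h h "2*pi + h" W] by simp
  have "(\<lambda>x. W (x + h)) integrable_on {0..2*pi}"
    using integrable_shift_real_ivl[OF W_integrable[of h "2*pi + h"], of h] by simp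
  then have "integral {0..2*pi} (\<lambda>x. W (x + h) - W x) = integral {h..2*pi + h} W - integral {0..2*pi} W"
    by (simp add: Henstock_Kurzweil_Integration.integral_diff W_integrable s)
  also have "\<dots> = integral {2*pi..2*pi + h} W - integral {0..h} W"
    using Henstock_Kurzweil_Integration.integral_combine[OF _ _ W_integrable, of 0 h "2*pi + h"]
      Henstock_Kurzweil_Integration.integral_combine[OF _ _ W_integrable, of 0 "2*pi" "2*pi + h"] assms by simp
  also have "\<dots> \<le> integral {2*pi..2*pi + h} (\<lambda>_. W (4 * pi)) - integral {0..h} (\<lambda>_. W 0)"
    using assms by (intro diff_mono integral_le W_integrable) (auto intro!: monoD[OF mono_W])
  also have "\<dots> = h * (W (4 * pi) - W 0)" using assms by (simp add: algebra_simps)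
  finally show ?thesis .
qed

text \<open>Translation by half a period \<open>\<pi>/|k|\<close> of the exponential changes its sign, so the coefficient
  is half that of the difference of \<open>F\<close> and its translate.\<close>

lemma norm_fourier_coeff_le:
  assumes "k \<noteq> 0"
  shows "norm (fourier_coeff F k) \<le> ((W (4 * pi) - W 0) / 4) / \<bar>of_int k\<bar>"
proof -
  define h where "h = pi / \<bar>of_int k\<bar>"
  have k1: "(1::real) \<le> \<bar>of_int k\<bar>" using assms by linarith
  have h: "0 \<le> h" "h \<le> 2 * pi"
    using k1 mult_left_mono[OF k1, of pi] by (auto simp: h_def field_simps)
  define P where "P x = F x * cis (- (of_int k * x))" for x
  have P_per: "P (x + 2 * pi) = P x" for x
  proof -
    have "cis (- (of_int k * (x + 2 * pi))) = cis (- (of_int k * x)) * cis (2 * pi * of_int (- k))"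
      by (simp add: cis_mult algebra_simps)
    also have "cis (2 * pi * of_int (- k)) = 1"
      by (rule cis_multiple_2pi) auto
    finally show ?thesis by (simp add: P_def periodic)
  qed
  have P_int: "P integrable_on {a..b}" for a b
    unfolding P_def by (rule integrable_mult) (intro continuous_intros)
  have P_h: "P (x + h) = - (F (x + h) * cis (- (of_int k * x)))" for x
  proof -
    have "of_int k * h = pi \<or> of_int k * h = - pi"
      using assms by (cases "k > 0") (auto simp: h_def)
    then have "cis (- (of_int k * h)) = -1" by (auto simp: complex_eq_iff)
    moreover have "cis (- (of_int k * (x + h))) = cis (- (of_int k * x)) * cis (- (of_int k * h))"
      by (simp add: cis_mult algebra_simps)
    ultimately show ?thesis by (simp add: P_def)
  qed
  have "integral {0..2*pi} (\<lambda>x. P (x + h)) = integral {h..h + 2*pi} P"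
    using integral_shift_real_ivl[of h h "h + 2*pi" P] by simp
  also have "\<dots> = integral {0..0 + 2*pi} P"
    by (rule integral_shift_period) (auto simp: P_per P_int)
  finally have eq: "integral {0..2*pi} (\<lambda>x. P (x + h)) = integral {0..2*pi} P" by simp
  have Ph_int: "(\<lambda>x. P (x + h)) integrable_on {0..2*pi}"
    using integrable_shift_real_ivl[OF P_int[of h "2*pi + h"], of h] by simp
  have "norm (2 * integral {0..2*pi} P) = norm (integral {0..2*pi} (\<lambda>x. P x + P (x + h)))"
    by (simp add: Henstock_Kurzweil_Integration.integral_add P_int Ph_int eq)
  also have "\<dots> \<le> integral {0..2*pi} (\<lambda>x. W (x + h) - W x)"
  proof (rule integral_norm_bound_integral)
    show "(\<lambda>x. P x + P (x + h)) integrable_on {0..2*pi}"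
      by (intro integrable_add P_int Ph_int)
    show "(\<lambda>x. W (x + h) - W x) integrable_on {0..2*pi}"
      using integrable_shift_real_ivl[OF W_integrable[of h "2*pi + h"], of h]
      by (intro integrable_diff W_integrable) auto
    show "norm (P x + P (x + h)) \<le> W (x + h) - W x" for x
    proof -
      have "P x + P (x + h) = - ((F (x + h) - F x) * cis (- (of_int k * x)))"
        unfolding P_h by (simp add: P_def algebra_simps)
      then have "norm (P x + P (x + h)) = norm (F (x + h) - F x)"
        by (simp add: norm_mult)
      with var_le[of x "x + h"] h show ?thesis by simp
    qed
  qed
  also have "\<dots> \<le> h * (W (4 * pi) - W 0)" by (rule integral_variation_le[OF h])
  finally have "norm (integral {0..2*pi} P) \<le> h * (W (4 * pi) - W 0) / 2" by (simp add: norm_mult)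
  then have "norm (integral {0..2*pi} P) / (2 * pi) \<le> h * (W (4 * pi) - W 0) / 2 / (2 * pi)"
    by (rule divide_right_mono) simp
  then show ?thesis
    unfolding fourier_coeff_cis P_def[symmetric] by (simp add: norm_divide norm_mult h_def mult.commute)
qed

text \<open>Only the two modes of index \<open>Suc n\<close> and \<open>- Suc n\<close> are new, and
  both coefficients are O(1/n). This is the hypothesis of the Tauberian theorem.\<close>

lemma fourier_sum_step:
  "norm (fourier_sum F (Suc n) y - fourier_sum F n y) \<le> ((W (4 * pi) - W 0) / 2) / real (Suc n)"
proof -
  have "{- int (Suc n)..int (Suc n)} = insert (int (Suc n)) (insert (- int (Suc n)) {- int n..int n})"
    by auto
  then have "fourier_sum F (Suc n) y - fourier_sum F n y
    = fourier_coeff F (int (Suc n)) * cis (of_int (int (Suc n)) * y)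
      + fourier_coeff F (- int (Suc n)) * cis (of_int (- int (Suc n)) * y)"
    by (simp add: fourier_sum_def)
  also have "norm \<dots> \<le> norm (fourier_coeff F (int (Suc n))) + norm (fourier_coeff F (- int (Suc n)))"
    by (rule order_trans[OF norm_triangle_ineq]) (simp add: norm_mult)
  also have "\<dots> \<le> ((W (4 * pi) - W 0) / 4) / real (Suc n) + ((W (4 * pi) - W 0) / 4) / real (Suc n)"
    using norm_fourier_coeff_le[of "int (Suc n)"] norm_fourier_coeff_le[of "- int (Suc n)"]
    by (intro add_mono) (auto simp: add.commute)
  also have "\<dots> = ((W (4 * pi) - W 0) / 2) / real (Suc n)"
  proof -
    have "c / 4 / d + c / 4 / d = c / 2 / d" for c d :: real by simp
    then show ?thesis .
  qed
  finally show ?thesis .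
qed

end

subsection \<open>The Fejer kernel\<close>

text \<open>Written as a squared modulus the kernel is visibly nonnegative and continuous, with no
  quotient of sines to interpret at \<open>h = 0\<close>. It is normalised to total mass
  \<open>2 * pi\<close>.\<close>

definition fejer :: "nat \<Rightarrow> real \<Rightarrow> real" where
  "fejer n h = (norm (\<Sum>a\<le>n. cis (real a * h)))\<^sup>2 / real (Suc n)"

lemma sum_symmetric_int:
  fixes c :: "int \<Rightarrow> 'a::comm_monoid_add"
  shows "(\<Sum>k\<in>{- int n..int n}. c k) = c 0 + (\<Sum>j\<in>{1..n}. c (int j) + c (- int j))"
proof (induction n)
  case (Suc n)
  have "{- int (Suc n)..int (Suc n)} = insert (int (Suc n)) (insert (- int (Suc n)) {- int n..int n})"
    by auto
  then have "(\<Sum>k\<in>{- int (Suc n)..int (Suc n)}. c k)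
    = c (int (Suc n)) + (c (- int (Suc n)) + (\<Sum>k\<in>{- int n..int n}. c k))"
    by simp
  then show ?case using Suc by (simp add: ac_simps)
qed simp

text \<open>Induction on \<open>n\<close>: with \<open>A\<close> the exponential sum and
  \<open>c\<close> its next term, passing from \<open>A * cnj A\<close> to
  \<open>(A + c) * cnj (A + c)\<close> adds \<open>1 + cnj A * c + A * cnj c\<close>. The mixed
  terms are the positive and negative halves of the next Dirichlet kernel.\<close>

lemma sum_dirichlet_eq_fejer:
  "(\<Sum>m\<le>n. \<Sum>k\<in>{- int m..int m}. cis (of_int k * h)) = of_real (real (Suc n) * fejer n h)"
proof -
  have "(\<Sum>m\<le>n. \<Sum>k\<in>{- int m..int m}. cis (of_int k * h))
      = (\<Sum>a\<le>n. cis (real a * h)) * cnj (\<Sum>a\<le>n. cis (real a * h))"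
  proof (induction n)
    case (Suc n)
    define A where "A = (\<Sum>a\<le>n. cis (real a * h))"
    define c where "c = cis (real (Suc n) * h)"
    have 1: "A * cnj c = (\<Sum>j\<in>{1..Suc n}. cis (- (real j * h)))"
    proof -
      have "A * cnj c = (\<Sum>a\<le>n. cis (- (real (Suc n - a) * h)))"
        unfolding A_def c_def cis_cnj sum_distrib_right cis_mult
        by (intro sum.cong refl arg_cong[of _ _ cis]) (auto simp: of_nat_diff algebra_simps)
      also have "\<dots> = (\<Sum>j\<in>{1..Suc n}. cis (- (real j * h)))"
        by (rule sum.reindex_bij_witness[of _ "\<lambda>j. Suc n - j" "\<lambda>a. Suc n - a"]) auto
      finally show ?thesis .
    qed
    have "cnj A * c = cnj (A * cnj c)" by simp
    also have "\<dots> = (\<Sum>j\<in>{1..Suc n}. cis (real j * h))"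
      unfolding 1 by (simp add: cis_cnj)
    finally have 2: "cnj A * c = (\<Sum>j\<in>{1..Suc n}. cis (real j * h))" .
    have 3: "c * cnj c = 1" by (simp add: c_def cis_cnj cis_mult)
    have "(\<Sum>k\<in>{- int (Suc n)..int (Suc n)}. cis (of_int k * h)) = 1 + cnj A * c + A * cnj c"
      unfolding 1 2 by (subst sum_symmetric_int) (simp add: sum.distrib)
    with Suc have "(\<Sum>m\<le>Suc n. \<Sum>k\<in>{- int m..int m}. cis (of_int k * h))
        = A * cnj A + (1 + cnj A * c + A * cnj c)"
      by (simp add: A_def)
    also have "\<dots> = (A + c) * cnj (A + c)"
      using 3 by (simp add: algebra_simps)
    finally show ?case by (simp add: A_def c_def)
  qed simp
  also have "\<dots> = of_real ((norm (\<Sum>a\<le>n. cis (real a * h)))\<^sup>2)"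
    unfolding complex_norm_square[symmetric] by simp
  finally show ?thesis by (simp add: fejer_def del: of_nat_Suc)
qed

lemma fejer_nonneg: "0 \<le> fejer n h"
  by (simp add: fejer_def)

lemma fejer_even: "fejer n (- h) = fejer n h"
proof -
  have "(\<Sum>a\<le>n. cis (real a * - h)) = cnj (\<Sum>a\<le>n. cis (real a * h))"
    by (simp add: cis_cnj)
  then show ?thesis by (simp only: fejer_def complex_mod_cnj)
qed

lemma continuous_on_fejer: "continuous_on S (fejer n)"
  unfolding fejer_def by (intro continuous_intros) simp

text \<open>The geometric sum \<open>A\<close> satisfies
  \<open>(1 - cis h) * A = 1 - cis h ^ Suc n\<close>, of norm at most 2, and the squared norm of
  \<open>1 - cis h\<close> is \<open>2 * (1 - cos h)\<close>, which stays away from 0.\<close>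

lemma fejer_le:
  assumes "0 < \<delta>" "\<delta> \<le> \<bar>h\<bar>" "\<bar>h\<bar> \<le> pi"
  shows "fejer n h \<le> 2 / (1 - cos \<delta>) / real (Suc n)"
proof -
  have "cos \<bar>h\<bar> \<le> cos \<delta>" using assms by (intro cos_monotone_0_pi_le) auto
  then have le: "1 - cos \<delta> \<le> 1 - cos h" by simp
  have pos: "0 < 1 - cos \<delta>" using cos_monotone_0_pi[of 0 \<delta>] assms by simp
  define A where "A = (\<Sum>a\<le>n. cis (real a * h))"
  have "A = (\<Sum>a\<le>n. cis h ^ a)" by (simp add: A_def Complex.DeMoivre)
  then have "(1 - cis h) * A = 1 - cis h ^ Suc n"
    by (simp add: sum_gp_basic)
  then have "norm (1 - cis h) * norm A = norm (1 - cis h ^ Suc n)"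
    by (metis norm_mult)
  also have "\<dots> \<le> 2"
    by (rule order_trans[OF norm_triangle_ineq4]) (simp add: norm_power norm_mult)
  finally have "(norm (1 - cis h) * norm A)\<^sup>2 \<le> 2\<^sup>2"
    by (intro power_mono) auto
  moreover have "(norm (1 - cis h))\<^sup>2 = 2 * (1 - cos h)"
  proof -
    have "(norm (1 - cis h))\<^sup>2 = (1 - cos h)\<^sup>2 + (sin h)\<^sup>2" by (simp add: cmod_power2)
    also have "\<dots> = 2 * (1 - cos h)"
      using sin_cos_squared_add[of h] by (simp add: power2_eq_square algebra_simps)
    finally show ?thesis .
  qed
  ultimately have "2 * (1 - cos h) * (norm A)\<^sup>2 \<le> 4" by (simp add: power_mult_distrib del: right_diff_distrib_numeral)
  moreover have "(1 - cos \<delta>) * (norm A)\<^sup>2 \<le> (1 - cos h) * (norm A)\<^sup>2"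
    using le by (intro mult_right_mono) auto
  ultimately have "(1 - cos \<delta>) * (norm A)\<^sup>2 \<le> 2" by linarith
  then have "(norm A)\<^sup>2 \<le> 2 / (1 - cos \<delta>)" using pos by (simp add: field_simps)
  then show ?thesis unfolding fejer_def A_def[symmetric] by (intro divide_right_mono) auto
qed

lemma integral_cis:
  "integral {-pi..pi} (\<lambda>h. cis (of_int k * h)) = (if k = 0 then 2 * of_real pi else 0)"
proof (cases "k = 0")
  case True
  then show ?thesis by (simp add: scaleR_conv_of_real)
next
  case False
  define c where "c = \<i> * complex_of_int k"
  have c: "c \<noteq> 0" using False by (simp add: c_def)
  have cis_c: "cis (of_int k * h) = exp (c * of_real h)" for h
    by (simp add: c_def cis_conv_exp mult.assoc)
  have "((\<lambda>h. cis (of_int k * h)) has_integral (exp (c * of_real pi) / c - exp (c * of_real (-pi)) / c)) {-pi..pi}"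
  proof (rule fundamental_theorem_of_calculus)
    show "((\<lambda>h. exp (c * of_real h) / c) has_vector_derivative cis (of_int k * h)) (at h within {-pi..pi})" for h
      unfolding cis_c
      by (rule has_vector_derivative_real_field) (use c in \<open>auto intro!: derivative_eq_intros\<close>)
  qed simp
  moreover have "exp (c * of_real pi) = exp (c * of_real (-pi))"
  proof -
    have "exp (c * of_real pi) / exp (c * of_real (-pi)) = cis (2 * pi * of_int k)"
      by (simp add: c_def cis_conv_exp exp_diff[symmetric] algebra_simps)
    also have "\<dots> = 1" by (rule cis_multiple_2pi) auto
    finally show ?thesis by simp
  qed
  ultimately show ?thesis using False by (simp add: integral_unique)
qed

text \<open>By orthogonality each of the \<open>Suc n\<close> Dirichlet kernels contributes only its
  constant mode.\<close>

lemma integral_fejer: "integral {-pi..pi} (fejer n) = 2 * pi"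
proof -
  have "complex_of_real (real (Suc n) * integral {-pi..pi} (fejer n))
      = integral {-pi..pi} (\<lambda>h. complex_of_real (real (Suc n) * fejer n h))"
    by (intro integral_unique[symmetric] has_integral_of_real has_integral_mult_right
          integrable_integral integrable_continuous_real continuous_on_fejer)
  also have "\<dots> = (\<Sum>m\<le>n. \<Sum>k\<in>{- int m..int m}. integral {-pi..pi} (\<lambda>h. cis (of_int k * h)))"
    unfolding sum_dirichlet_eq_fejer[symmetric]
    by (subst integral_sum; (intro sum.cong refl integral_sum)?)
       (auto intro!: integrable_sum integrable_continuous_real continuous_intros)
  also have "\<dots> = (\<Sum>m\<le>n. 2 * of_real pi)"
    by (simp add: integral_cis)
  also have "\<dots> = complex_of_real (real (Suc n) * (2 * pi))" by simp
  finally have "real (Suc n) * integral {-pi..pi} (fejer n) = real (Suc n) * (2 * pi)"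
    unfolding of_real_eq_iff .
  then show ?thesis by (simp del: of_nat_Suc)
qed

section \<open>Cesaro means as convolutions with the Fejer kernel\<close>

context periodic_bv
begin

text \<open>Substitute \<open>x = y - h\<close> in the coefficient integral; periodicity brings the
  interval of integration back to a standard period.\<close>

lemma fourier_term_eq:
  "fourier_coeff F k * cis (of_int k * y)
    = integral {-pi..pi} (\<lambda>h. F (y - h) * cis (of_int k * h)) / (2 * of_real pi)"
proof -
  define P where "P x = F x * cis (of_int k * (y - x))" for x
  have P_per: "P (x + 2 * pi) = P x" for x
  proof -
    have "cis (of_int k * (y - (x + 2 * pi))) = cis (of_int k * (y - x)) * cis (2 * pi * of_int (- k))"
      by (simp add: cis_mult algebra_simps)
    also have "cis (2 * pi * of_int (- k)) = 1"
      by (rule cis_multiple_2pi) auto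
    finally show ?thesis by (simp add: P_def periodic)
  qed
  have P_int: "P integrable_on {a..b}" for a b
    unfolding P_def by (rule integrable_mult) (intro continuous_intros)
  have "integral {-pi..pi} (\<lambda>h. F (y - h) * cis (of_int k * h)) = integral {-pi..pi} (\<lambda>h. P (- h + y))"
    by (simp add: P_def)
  also have "\<dots> = integral {-pi..pi} (\<lambda>h. P (h + y))"
    using Henstock_Kurzweil_Integration.integral_reflect_real[of pi "- pi" "\<lambda>h. P (h + y)"] by simp
  also have "\<dots> = integral {y - pi..(y - pi) + 2*pi} P"
    using integral_shift_real_ivl[of "y - pi" y "y + pi" P] by (simp add: algebra_simps)
  also have "\<dots> = integral {0..0 + 2*pi} P"
    by (rule integral_shift_period) (auto simp: P_per P_int)
  also have "P = (\<lambda>x. F x * cis (- (of_int k * x)) * cis (of_int k * y))"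
    by (simp add: fun_eq_iff P_def cis_mult mult.assoc right_diff_distrib)
  finally show ?thesis
    unfolding fourier_coeff_cis by simp
qed

lemma integrable_reflected_mult:
  assumes "continuous_on UNIV c"
  shows "(\<lambda>h. F (y - h) * c h) integrable_on {a..b}"
proof -
  \<comment> \<open>Reflection reverses the order, so the dominating function must be reflected and
    negated to remain increasing.\<close>
  interpret R: periodic_bv "\<lambda>h. F (y - h)" "\<lambda>h. - W (y - h)"
  proof
    show "F (y - (x + 2 * pi)) = F (y - x)" for x
      using periodic[of "y - (x + 2 * pi)"] by simp
    show "norm (F (y - b) - F (y - a)) \<le> - W (y - b) - - W (y - a)" if "a \<le> b" for a b
      using var_le[of "y - b" "y - a"] that by (simp add: norm_minus_commute)
  qed
  show ?thesis by (rule R.integrable_mult[OF assms])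
qed

lemma cesaro_eq:
  "(\<Sum>m\<le>n. fourier_sum F m y) /\<^sub>R real (Suc n)
    = integral {-pi..pi} (\<lambda>h. F (y - h) * of_real (fejer n h)) / (2 * of_real pi)"
proof -
  have int: "(\<lambda>h. F (y - h) * cis (of_int k * h)) integrable_on {-pi..pi}" for k
    by (rule integrable_reflected_mult) (intro continuous_intros)
  have "(\<Sum>m\<le>n. fourier_sum F m y)
    = integral {-pi..pi} (\<lambda>h. \<Sum>m\<le>n. \<Sum>k\<in>{- int m..int m}. F (y - h) * cis (of_int k * h)) / (2 * of_real pi)"
    unfolding fourier_sum_def fourier_term_eq sum_divide_distrib[symmetric]
    by (simp add: integral_sum integrable_sum int)
  also have "(\<lambda>h. \<Sum>m\<le>n. \<Sum>k\<in>{- int m..int m}. F (y - h) * cis (of_int k * h))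
    = (\<lambda>h. of_nat (Suc n) * (F (y - h) * of_real (fejer n h)))"
    unfolding sum_distrib_left[symmetric] sum_dirichlet_eq_fejer by (simp add: fun_eq_iff algebra_simps)
  finally show ?thesis by (simp add: scaleR_conv_of_real divide_simps del: of_nat_Suc)
qed

end

subsection \<open>Pointwise convergence of Fourier series\<close>

lemma mean_value_at_if_isCont:
  assumes "isCont F y" shows "mean_value_at F y"
proof -
  have "((\<lambda>h. F (y + h)) \<longlongrightarrow> F y) (at_right 0)" "((\<lambda>h. F (y - h)) \<longlongrightarrow> F y) (at_right 0)"
    by (rule isCont_tendsto_compose[OF assms]; auto intro!: tendsto_eq_intros)+
  then have "((\<lambda>h. (F (y + h) + F (y - h)) / 2) \<longlongrightarrow> (F y + F y) / 2) (at_right 0)"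
    by (intro tendsto_intros) auto
  then show ?thesis by (simp add: mean_value_at_def)
qed

context periodic_bv
begin

text \<open>The kernel is nonnegative with mass \<open>2 * pi\<close>, so a Cesaro mean is a
  weighted average of values of \<open>F\<close>.\<close>

lemma norm_cesaro_le: "norm ((\<Sum>m\<le>n. fourier_sum F m y) /\<^sub>R real (Suc n)) \<le> bound"
proof -
  have "norm (integral {-pi..pi} (\<lambda>h. F (y - h) * of_real (fejer n h)))
      \<le> integral {-pi..pi} (\<lambda>h. bound * fejer n h)"
  proof (rule integral_norm_bound_integral)
    show "(\<lambda>h. F (y - h) * of_real (fejer n h)) integrable_on {-pi..pi}"
      by (intro integrable_reflected_mult continuous_intros continuous_on_fejer)
    show "(\<lambda>h. bound * fejer n h) integrable_on {-pi..pi}"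
      by (intro integrable_continuous_real continuous_intros continuous_on_fejer)
    show "norm (F (y - h) * of_real (fejer n h)) \<le> bound * fejer n h" for h
      using fejer_nonneg by (simp add: norm_mult norm_le_bound mult_right_mono)
  qed
  also have "\<dots> = bound * (2 * pi)" by (simp add: integral_fejer)
  finally show ?thesis by (simp only: cesaro_eq) (simp add: norm_divide norm_mult divide_simps)
qed

text \<open>The bound is uniform in \<open>n\<close> and \<open>y\<close>, which supplies the
  dominating constant for termwise integration. It combines the bound on Cesaro means with their
  bounded distance from the partial sums.\<close>

lemma norm_fourier_sum_le: "norm (fourier_sum F n y) \<le> bound + (W (4 * pi) - W 0) / 2"
proof -
  have "norm (fourier_sum F n y - (\<Sum>m\<le>n. fourier_sum F m y) /\<^sub>R real (Suc n)) \<le> (W (4 * pi) - W 0) / 2"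
    by (rule norm_diff_cesaro_le) (rule fourier_sum_step)
  then show ?thesis
    using norm_cesaro_le[of n y]
      norm_triangle_sub[of "fourier_sum F n y" "(\<Sum>m\<le>n. fourier_sum F m y) /\<^sub>R real (Suc n)"]
    by linarith
qed

text \<open>Evenness of the kernel allows \<open>F (y - h)\<close> to be replaced by the symmetric
  average, and its mass writes \<open>F y\<close> as an integral against the same kernel.\<close>

lemma cesaro_minus_eq:
  "(\<Sum>m\<le>n. fourier_sum F m y) /\<^sub>R real (Suc n) - F y
    = integral {-pi..pi} (\<lambda>h. ((F (y + h) + F (y - h)) / 2 - F y) * of_real (fejer n h)) / (2 * of_real pi)"
proof -
  define J where "J = integral {-pi..pi} (\<lambda>h. F (y - h) * of_real (fejer n h))"
  have 1: "((\<lambda>h. F (y - h) * of_real (fejer n h)) has_integral J) {-pi..pi}"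
    unfolding J_def
    by (intro integrable_integral integrable_reflected_mult continuous_intros continuous_on_fejer)
  have 2: "((\<lambda>h. F (y + h) * of_real (fejer n h)) has_integral J) {-pi..pi}"
    using Henstock_Kurzweil_Integration.has_integral_reflect_real[THEN iffD2, OF 1]
    by (simp add: fejer_even)
  have "(fejer n has_integral (2 * pi)) {-pi..pi}"
    using integrable_integral[of "fejer n" "{-pi..pi}"]
    by (simp add: integral_fejer integrable_continuous_real continuous_on_fejer)
  then have 3: "((\<lambda>h. F y * of_real (fejer n h)) has_integral (F y * of_real (2 * pi))) {-pi..pi}"
    by (intro has_integral_mult_right has_integral_of_real)
  have "((\<lambda>h. (1/2) * (F (y + h) * of_real (fejer n h)) + (1/2) * (F (y - h) * of_real (fejer n h))
        - F y * of_real (fejer n h)) has_integral ((1/2) * J + (1/2) * J - F y * of_real (2 * pi))) {-pi..pi}"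
    by (intro has_integral_diff has_integral_add has_integral_mult_right 1 2 3)
  moreover have "(\<lambda>h. (1/2) * (F (y + h) * of_real (fejer n h)) + (1/2) * (F (y - h) * of_real (fejer n h))
        - F y * of_real (fejer n h))
      = (\<lambda>h. ((F (y + h) + F (y - h)) / 2 - F y) * of_real (fejer n h))"
    by (simp add: fun_eq_iff algebra_simps add_divide_distrib)
  ultimately have "integral {-pi..pi} (\<lambda>h. ((F (y + h) + F (y - h)) / 2 - F y) * of_real (fejer n h))
      = J - F y * of_real (2 * pi)"
    by (simp add: integral_unique)
  then show ?thesis
    by (simp only: cesaro_eq J_def[symmetric]) (simp add: divide_simps)
qed

text \<open>The kernel is an approximate identity: near 0 the symmetric average is within
  \<open>r / 2\<close> of \<open>F y\<close>, and on the rest of the period the kernel is O(1/n)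
  while the deviation stays bounded.\<close>

lemma cesaro_tendsto:
  assumes "mean_value_at F y"
  shows "(\<lambda>n. (\<Sum>m\<le>n. fourier_sum F m y) /\<^sub>R real (Suc n)) \<longlonglongrightarrow> F y"
proof (rule LIMSEQ_I)
  fix r :: real assume "0 < r"
  define \<phi> where "\<phi> h = (F (y + h) + F (y - h)) / 2 - F y" for h
  have \<phi>_bound: "norm (\<phi> h) \<le> 2 * bound" for h
  proof -
    have "norm (F (y + h) + F (y - h)) \<le> 2 * bound"
      using norm_triangle_ineq[of "F (y + h)" "F (y - h)"] norm_le_bound[of "y + h"] norm_le_bound[of "y - h"]
      by linarith
    then have "norm ((F (y + h) + F (y - h)) / 2) \<le> bound" by (simp add: norm_divide)
    then show ?thesis
      using norm_triangle_ineq4[of "(F (y + h) + F (y - h)) / 2" "F y"] norm_le_bound[of y]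
      unfolding \<phi>_def by linarith
  qed
  have "((\<lambda>h. (F (y + h) + F (y - h)) / 2) \<longlongrightarrow> F y) (at_right 0)"
    using assms by (simp add: mean_value_at_def)
  then have "\<forall>\<^sub>F h in at_right 0. dist ((F (y + h) + F (y - h)) / 2) (F y) < r / 2"
    using \<open>0 < r\<close> by (intro tendstoD) auto
  then obtain d where d: "0 < d" "\<And>h. 0 < h \<Longrightarrow> h < d \<Longrightarrow> norm (\<phi> h) < r / 2"
    unfolding eventually_at_right_field by (auto simp: dist_norm \<phi>_def)
  \<comment> \<open>The cap at \<open>pi\<close> keeps \<open>\<delta>\<close> in the range where
    the cosine is decreasing.\<close>
  define \<delta> where "\<delta> = min d pi"
  have \<delta>: "0 < \<delta>" "\<delta> \<le> pi" using d by (auto simp: \<delta>_def)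
  have \<phi>_small: "norm (\<phi> h) \<le> r / 2" if "\<bar>h\<bar> < \<delta>" for h
  proof -
    \<comment> \<open>The limit at 0 is one-sided; evenness of \<open>\<phi>\<close> and its
      vanishing at 0 extend the estimate to both sides.\<close>
    have "\<phi> 0 = 0" by (simp add: \<phi>_def)
    moreover have "\<phi> h = \<phi> \<bar>h\<bar>" by (simp add: \<phi>_def abs_if add.commute)
    ultimately show ?thesis
      using d(2)[of "\<bar>h\<bar>"] that \<open>0 < r\<close> by (cases "h = 0") (auto simp: \<delta>_def)
  qed
  define M where "M = 2 * bound * (2 / (1 - cos \<delta>))"
  have "0 < 1 - cos \<delta>" using cos_monotone_0_pi[of 0 \<delta>] \<delta> by simp
  then have "0 \<le> M" using bound_nonneg by (simp add: M_def)
  have main: "norm ((\<Sum>m\<le>n. fourier_sum F m y) /\<^sub>R real (Suc n) - F y) \<le> r / 2 + M / real (Suc n)" for n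
  proof -
    have "norm (integral {-pi..pi} (\<lambda>h. \<phi> h * of_real (fejer n h)))
      \<le> integral {-pi..pi} (\<lambda>h. r / 2 * fejer n h + M / real (Suc n))"
    proof (rule integral_norm_bound_integral)
      have 1: "(\<lambda>h. F (y - h) * of_real (fejer n h)) integrable_on {-pi..pi}"
        by (intro integrable_reflected_mult continuous_intros continuous_on_fejer)
      then have 2: "(\<lambda>h. F (y + h) * of_real (fejer n h)) integrable_on {-pi..pi}"
        using Henstock_Kurzweil_Integration.integrable_reflect_real[THEN iffD2, OF 1] by (simp add: fejer_even)
      have 3: "(\<lambda>h. F y * of_real (fejer n h)) integrable_on {-pi..pi}"
        by (intro integrable_continuous_real continuous_intros continuous_on_fejer)
      have "(\<lambda>h. (1/2) * (F (y + h) * of_real (fejer n h)) + (1/2) * (F (y - h) * of_real (fejer n h))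
          - F y * of_real (fejer n h)) integrable_on {-pi..pi}"
        by (intro integrable_diff integrable_add integrable_on_mult_right 1 2 3)
      moreover have "(\<lambda>h. (1/2) * (F (y + h) * of_real (fejer n h)) + (1/2) * (F (y - h) * of_real (fejer n h))
          - F y * of_real (fejer n h)) = (\<lambda>h. \<phi> h * of_real (fejer n h))"
        by (simp add: fun_eq_iff \<phi>_def algebra_simps add_divide_distrib)
      ultimately show "(\<lambda>h. \<phi> h * of_real (fejer n h)) integrable_on {-pi..pi}" by simp
      show "(\<lambda>h. r / 2 * fejer n h + M / real (Suc n)) integrable_on {-pi..pi}"
        by (intro integrable_continuous_real continuous_intros continuous_on_fejer)
      fix h assume h: "h \<in> {-pi..pi}"
      show "norm (\<phi> h * of_real (fejer n h)) \<le> r / 2 * fejer n h + M / real (Suc n)"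
      proof (cases "\<bar>h\<bar> < \<delta>")
        case True
        have "norm (\<phi> h) * fejer n h \<le> r / 2 * fejer n h"
          by (intro mult_right_mono \<phi>_small True fejer_nonneg)
        moreover have "0 \<le> M / real (Suc n)" using \<open>0 \<le> M\<close> by simp
        ultimately show ?thesis using fejer_nonneg[of n h] by (simp add: norm_mult)
      next
        case False
        have "norm (\<phi> h) * fejer n h \<le> (2 * bound) * (2 / (1 - cos \<delta>) / real (Suc n))"
          using False h \<delta> bound_nonneg
          by (intro mult_mono \<phi>_bound fejer_nonneg fejer_le) auto
        also have "\<dots> = M / real (Suc n)" by (simp add: M_def)
        finally show ?thesis
          using fejer_nonneg[of n h] \<open>0 < r\<close> by (simp add: norm_mult add_increasing)
      qed
    qed
    also have "\<dots> = (r / 2 + M / real (Suc n)) * (2 * pi)"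
      by (subst Henstock_Kurzweil_Integration.integral_add)
        (auto simp: integral_fejer algebra_simps intro!: integrable_continuous_real continuous_intros continuous_on_fejer simp del: of_nat_Suc)
    finally show ?thesis
      unfolding cesaro_minus_eq \<phi>_def[symmetric]
      by (simp add: norm_divide norm_mult pos_divide_le_eq del: of_nat_Suc)
  qed
  have "(\<lambda>n. r / 2 + M / real (Suc n)) \<longlonglongrightarrow> r / 2 + 0"
    by (intro tendsto_add tendsto_const LIMSEQ_Suc[OF lim_const_over_n])
  then have "\<forall>\<^sub>F n in sequentially. r / 2 + M / real (Suc n) < r"
    by (rule order_tendstoD(2)) (use \<open>0 < r\<close> in simp)
  then show "\<exists>n0. \<forall>n\<ge>n0. norm ((\<Sum>m\<le>n. fourier_sum F m y) /\<^sub>R real (Suc n) - F y) < r"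
    unfolding eventually_sequentially using main by (meson order.strict_trans1)
qed

text \<open>The Dirichlet-Jordan theorem, obtained from Fejer's theorem by the Tauberian
  theorem.\<close>

theorem fourier_sum_tendsto:
  assumes "mean_value_at F y"
  shows "(\<lambda>n. fourier_sum F n y) \<longlonglongrightarrow> F y"
  by (rule hardy_tauberian[OF fourier_sum_step cesaro_tendsto[OF assms]])

end

subsection \<open>Periodic extensions and discrete Fourier transform\<close>

text \<open>\<open>V x\<close> is the total variation over \<open>{a..x}\<close>. A partition of
  \<open>{a..x}\<close> prolonged to \<open>y\<close> has its sum raised by at least the increment
  of \<open>h\<close> from \<open>x\<close> to \<open>y\<close>.\<close>

lemma bounded_variation_imp_dominated:
  assumes "bounded_variation_on a b h" and "a \<le> b"
  obtains V :: "real \<Rightarrow> real"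
    where "\<And>x y. a \<le> x \<Longrightarrow> x \<le> y \<Longrightarrow> y \<le> b \<Longrightarrow> norm (h y - h x) \<le> V y - V x"
proof
  obtain B where B: "\<And>(n::nat) s. (\<forall>i\<le>n. s i \<in> {a..b}) \<Longrightarrow> (\<forall>i<n. s i \<le> s (Suc i)) \<Longrightarrow>
      (\<Sum>i<n. norm (h (s (Suc i)) - h (s i))) \<le> B"
    using assms unfolding bounded_variation_on_def by blast
  define A where "A x = {\<Sum>i<n. norm (h (s (Suc i)) - h (s i)) | (n::nat) s.
      (\<forall>i\<le>n. s i \<in> {a..x}) \<and> (\<forall>i<n. s i \<le> s (Suc i))}" for x
  define V where "V x = Sup (A x)" for x
  have bdd: "bdd_above (A x)" if "x \<le> b" for x
  proof (rule bdd_aboveI)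
    fix r assume "r \<in> A x"
    then show "r \<le> B" using that by (fastforce simp: A_def intro!: B)
  qed
  have ne: "A x \<noteq> {}" if "a \<le> x" for x
  proof -
    have "(\<Sum>i<0. norm (h ((\<lambda>_. a) (Suc i)) - h ((\<lambda>_. a) i))) \<in> A x"
      unfolding A_def using that by (intro CollectI exI[of _ "0::nat"] exI[of _ "\<lambda>_. a"]) auto
    then show ?thesis by blast
  qed
  fix x y assume xy: "a \<le> x" "x \<le> y" "y \<le> b"
  have "V x \<le> V y - norm (h y - h x)"
    unfolding V_def[of x]
  proof (rule cSup_least[OF ne[OF \<open>a \<le> x\<close>]])
    fix r assume "r \<in> A x"
    then obtain n s where r: "r = (\<Sum>i<n. norm (h (s (Suc i)) - h (s i)))"
      and s: "\<And>i. i \<le> n \<Longrightarrow> s i \<in> {a..x}" "\<And>i. i < n \<Longrightarrow> s i \<le> s (Suc i)"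
      unfolding A_def by blast
    \<comment> \<open>The old last point \<open>s n\<close> may lie before \<open>x\<close>, so
      \<open>x\<close> is appended first and \<open>y\<close> after it.\<close>
    define s' where "s' i = (if i \<le> n then s i else if i = Suc n then x else y)" for i
    have "(\<Sum>i<Suc (Suc n). norm (h (s' (Suc i)) - h (s' i))) \<in> A y"
      unfolding A_def
    proof (intro CollectI exI conjI allI impI, rule refl)
      show "s' i \<in> {a..y}" for i
        using s(1)[of i] xy by (auto simp: s'_def)
      show "s' i \<le> s' (Suc i)" if "i < Suc (Suc n)" for i
        using s(1)[of i] s(2)[of i] xy that by (auto simp: s'_def not_le less_Suc_eq)
    qed
    then have "(\<Sum>i<Suc (Suc n). norm (h (s' (Suc i)) - h (s' i))) \<le> V y"
      unfolding V_def using xy by (intro cSup_upper bdd)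
    moreover have "(\<Sum>i<n. norm (h (s' (Suc i)) - h (s' i))) = r"
      unfolding r by (intro sum.cong) (auto simp: s'_def)
    ultimately have "r + norm (h x - h (s n)) + norm (h y - h x) \<le> V y"
      by (simp add: s'_def)
    then show "r \<le> V y - norm (h y - h x)"
      using norm_ge_zero[of "h x - h (s n)"] by linarith
  qed
  then show "norm (h y - h x) \<le> V y - V x" by simp
qed

lemma periodic_bv_periodic_ext:
  assumes "bounded_variation_on 0 (2 * pi) h"
  obtains W where "periodic_bv (periodic_ext h) W"
proof -
  obtain V :: "real \<Rightarrow> real"
    where V: "\<And>x y. 0 \<le> x \<Longrightarrow> x \<le> y \<Longrightarrow> y \<le> 2 * pi \<Longrightarrow> norm (h y - h x) \<le> V y - V x"
    using bounded_variation_imp_dominated[OF assms] by auto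
  have V_mono: "V x \<le> V y" if "0 \<le> x" "x \<le> y" "y \<le> 2 * pi" for x y
    using order_trans[OF norm_ge_zero V[OF that]] by simp
  define D where "D = V (2 * pi) - V 0"
  \<comment> \<open>If a multiple of \<open>2 * pi\<close> lies between the points,
    \<open>V y' - V x'\<close> may be negative, but it is at least \<open>- D\<close>. Its absolute
    value is then at most \<open>V y' - V x' + 2 * D\<close>; hence \<open>2 * D\<close> per
    period.\<close>
  define W where "W x = V (x rmod (2 * pi)) + 2 * D * of_int \<lfloor>x / (2 * pi)\<rfloor>" for x
  have range: "0 \<le> x rmod (2 * pi)" "x rmod (2 * pi) \<le> 2 * pi" for x
    by (auto intro: rmod_nonneg rmod_le)
  have "periodic_bv (periodic_ext h) W"
  proof
    show "periodic_ext h (x + 2 * pi) = periodic_ext h x" for x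
      using rmod_add[of x "2 * pi" "2 * pi"] by (simp add: periodic_ext_def)
    fix x y :: real assume "x \<le> y"
    define x' y' where "x' = x rmod (2 * pi)" and "y' = y rmod (2 * pi)"
    have r: "0 \<le> x'" "x' \<le> 2 * pi" "0 \<le> y'" "y' \<le> 2 * pi"
      by (auto simp: x'_def y'_def range)
    have Vr: "V 0 \<le> V x'" "V x' \<le> V (2 * pi)" "V 0 \<le> V y'" "V y' \<le> V (2 * pi)"
      by (auto intro: V_mono r)
    have fl: "\<lfloor>x / (2 * pi)\<rfloor> \<le> \<lfloor>y / (2 * pi)\<rfloor>"
      using \<open>x \<le> y\<close> by (intro floor_mono divide_right_mono) auto
    have "norm (h y' - h x') \<le> W y - W x"
    proof (cases "\<lfloor>x / (2 * pi)\<rfloor> = \<lfloor>y / (2 * pi)\<rfloor>")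
      case True
      then have "x' \<le> y'" using \<open>x \<le> y\<close> by (simp add: x'_def y'_def rmod_def)
      with V[of x' y'] r True show ?thesis by (simp add: W_def x'_def y'_def)
    next
      case False
      then have "1 \<le> of_int \<lfloor>y / (2 * pi)\<rfloor> - (of_int \<lfloor>x / (2 * pi)\<rfloor> :: real)"
        using fl by linarith
      moreover have "0 \<le> D" using Vr by (simp add: D_def)
      ultimately have "2 * D * 1 \<le> 2 * D * (of_int \<lfloor>y / (2 * pi)\<rfloor> - of_int \<lfloor>x / (2 * pi)\<rfloor>)"
        by (intro mult_left_mono) auto
      then have "V y' - V x' + 2 * D \<le> W y - W x"
        by (simp add: W_def x'_def y'_def right_diff_distrib)
      moreover have "norm (h y' - h x') \<le> \<bar>V y' - V x'\<bar>"
        using V[of x' y'] V[of y' x'] r by (cases "x' \<le> y'") (auto simp: norm_minus_commute)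
      ultimately show ?thesis using Vr by (simp add: D_def)
    qed
    then show "norm (periodic_ext h y - periodic_ext h x) \<le> W y - W x"
      by (simp add: periodic_ext_def x'_def y'_def)
  qed
  then show ?thesis by (rule that)
qed

lemma fourier_coeff_periodic_ext: "fourier_coeff (periodic_ext h) k = fourier_coeff h k"
proof -
  have "integral {0..2*pi} (\<lambda>x. periodic_ext h x * exp (- \<i> * of_int k * of_real x))
      = integral {0..2*pi} (\<lambda>x. h x * exp (- \<i> * of_int k * of_real x))"
    by (rule integral_spike[of "{2 * pi}"]) (auto simp: periodic_ext_def)
  then show ?thesis by (simp add: fourier_coeff_def)
qed

text \<open>Inversion on the integers modulo \<open>M\<close>: \<open>a\<close> is the discrete
  transform of \<open>c\<close>, normalised by \<open>1 / M\<close>, and orthogonality of the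
  \<open>M\<close>-th roots of unity recovers \<open>c k\<close>.\<close>

lemma discrete_fourier:
  fixes c :: "int \<Rightarrow> complex" and M :: nat
  assumes "M > 0" and per: "\<And>k. c (k + int M) = c k"
  obtains a :: "nat \<Rightarrow> complex"
    where "\<And>k. c k = (\<Sum>j<M. a j * cis (- (of_int k * (2 * pi * real j / real M))))"
proof
  define a where "a j = (\<Sum>m<M. c (int m) * cis (2 * pi * real m * real j / real M)) / of_nat M" for j :: nat
  fix k :: int
  have per': "c (l + int M * i) = c l" for l i
  proof (induction i rule: int_induct[where k = 0])
    case (step1 i)
    then show ?case using per[of "l + int M * i"] by (simp add: algebra_simps)
  next
    case (step2 i)
    then show ?case using per[of "l + int M * (i - 1)"] by (simp add: algebra_simps)
  qed simp
  define m0 where "m0 = nat (k mod int M)"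
  have m0: "int m0 = k mod int M" "m0 < M"
    using \<open>M > 0\<close> by (auto simp: m0_def nat_less_iff)
  \<comment> \<open>The ratio is an \<open>M\<close>-th root of unity. It equals 1 exactly when
    \<open>m\<close> and \<open>k\<close> are congruent modulo \<open>M\<close>; otherwise the
    geometric sum vanishes.\<close>
  have geo: "(\<Sum>j<M. cis (2 * pi * (real m - of_int k) / real M) ^ j) = (if m = m0 then of_nat M else 0)"
    if "m < M" for m
  proof -
    define z where "z = cis (2 * pi * (real m - of_int k) / real M)"
    have "z ^ M = cis (2 * pi * of_int (int m - k))"
      using \<open>M > 0\<close> by (simp add: z_def Complex.DeMoivre)
    also have "\<dots> = 1" by (rule cis_multiple_2pi) auto
    finally have zM: "z ^ M = 1" .
    have eq: "2 * pi * x / real M = y * (2 * pi) \<longleftrightarrow> x = y * real M" for x y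
    proof -
      have "2 * pi * x / real M = y * (2 * pi) \<longleftrightarrow> (2 * pi) * (x / real M) = (2 * pi) * y"
        by (simp only: times_divide_eq_right mult.commute[of y])
      also have "\<dots> \<longleftrightarrow> x / real M = y" by (rule mult_left_cancel) simp
      also have "\<dots> \<longleftrightarrow> x = y * real M" using \<open>M > 0\<close> by (simp add: nonzero_divide_eq_eq)
      finally show ?thesis .
    qed
    have "z = 1 \<longleftrightarrow> (\<exists>n. 2 * pi * (real m - of_int k) / real M = of_int n * (2 * pi))"
      by (simp add: z_def cis_eq_1_iff)
    also have "\<dots> \<longleftrightarrow> (\<exists>n. real_of_int (int m - k) = of_int (n * int M))"
      unfolding eq by simp
    also have "\<dots> \<longleftrightarrow> (\<exists>n. int m - k = int M * n)"
      unfolding of_int_eq_iff by (simp add: mult.commute)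
    also have "\<dots> \<longleftrightarrow> int M dvd int m - k" by (simp add: dvd_def)
    also have "\<dots> \<longleftrightarrow> int m mod int M = k mod int M" by (simp add: mod_eq_dvd_iff)
    also have "\<dots> \<longleftrightarrow> m = m0" using that m0 by auto
    finally have "z = 1 \<longleftrightarrow> m = m0" .
    then show ?thesis
      unfolding z_def[symmetric] using zM by (auto simp: sum_gp_strict)
  qed
  have "(\<Sum>j<M. a j * cis (- (of_int k * (2 * pi * real j / real M))))
      = (\<Sum>j<M. \<Sum>m<M. c (int m) * cis (2 * pi * (real m - of_int k) / real M) ^ j) / of_nat M"
    unfolding a_def sum_divide_distrib sum_distrib_right
    by (intro sum.cong refl)
      (simp add: Complex.DeMoivre cis_mult diff_divide_distrib algebra_simps)
  also have "\<dots> = (\<Sum>m<M. c (int m) * (\<Sum>j<M. cis (2 * pi * (real m - of_int k) / real M) ^ j)) / of_nat M"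
    by (subst sum.swap) (simp add: sum_distrib_left)
  also have "\<dots> = (\<Sum>m<M. if m = m0 then c (int m) * of_nat M else 0) / of_nat M"
    by (intro arg_cong2[of _ _ _ _ "(/)"] sum.cong refl) (auto simp: geo)
  also have "\<dots> = c (int m0)" using m0 by (simp add: \<open>M > 0\<close>)
  also have "\<dots> = c k" using per'[of "k mod int M" "k div int M"] by (simp add: m0)
  finally show "c k = (\<Sum>j<M. a j * cis (- (of_int k * (2 * pi * real j / real M))))" by simp
qed

text \<open>Modulo \<open>2 * q\<close>, the power \<open>k ^ N\<close> depends only on the residue
  of \<open>k\<close>, and \<open>2 * q\<close> times \<open>pi * p / q\<close> is a multiple of
  \<open>2 * pi\<close>. This fixes the number \<open>2 * q\<close> of translates.\<close>

lemma power_phase_periodic: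
  fixes k :: int and p q N :: nat
  assumes "q > 0"
  obtains u :: int
  where "of_int (k + int (2 * q)) ^ N * (pi * real p / real q) = of_int k ^ N * (pi * real p / real q) + 2 * pi * of_int u"
proof -
  have "int (2 * q) dvd (k + int (2 * q)) ^ N - k ^ N"
    by (simp add: mod_eq_dvd_iff[symmetric] power_mod[symmetric, of "k + _"] power_mod)
  then obtain u where u: "(k + int (2 * q)) ^ N = k ^ N + int (2 * q) * u"
    unfolding dvd_def by (metis add.commute diff_add_cancel)
  have "of_int (k + int (2 * q)) ^ N = (of_int ((k + int (2 * q)) ^ N) :: real)" by simp
  also have "\<dots> = of_int k ^ N + 2 * real q * of_int u" unfolding u by simp
  finally have "of_int (k + int (2 * q)) ^ N * (pi * real p / real q)
     = of_int k ^ N * (pi * real p / real q) + 2 * pi * of_int (u * int p)"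
    using assms by (simp add: field_simps)
  then show ?thesis by (rule that)
qed

subsection \<open>Iterated primitives\<close>

lemma dx_inv_1: "dx_inv 1 P x = integral {0..x} P"
  by (simp add: dx_inv_def)

text \<open>The Taylor remainder of order \<open>Suc m\<close> vanishes at 0 and has derivative
  \<open>\<i> * k\<close> times the remainder of order \<open>m\<close>, so one integration from 0
  raises the order by one. Mode 0 is excluded because of the division by
  \<open>\<i> * k\<close>.\<close>

lemma funpow_dx_inv_trig:
  assumes A: "finite A" "0 \<notin> A" and "0 \<le> x"
  shows "(dx_inv 1 ^^ m) (\<lambda>y. \<Sum>k\<in>A. c k * cis (of_int k * y)) x
    = (\<Sum>k\<in>A. c k / (\<i> * of_int k) ^ m *
        (cis (of_int k * x) - (\<Sum>j<m. (\<i> * of_int k * of_real x) ^ j / fact j)))"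
  using \<open>0 \<le> x\<close>
proof (induction m arbitrary: x)
  case (Suc m)
  define R where "R l k y = cis (of_int k * y) - (\<Sum>j<l. (\<i> * of_int k * of_real y) ^ j / fact j)"
    for l k y
  have R_deriv: "(R (Suc m) k has_vector_derivative (\<i> * of_int k) * R m k y) (at y within S)" for k y S
  proof -
    define z where "z = \<i> * complex_of_int k"
    have "((\<lambda>w. exp (z * w) - (\<Sum>j<Suc m. (z * w) ^ j / fact j)) has_field_derivative
        (z * exp (z * of_real y) - (\<Sum>j<Suc m. of_nat j * (z * of_real y) ^ (j - 1) * z / fact j))) (at (of_real y))"
      by (auto intro!: derivative_eq_intros simp: mult_ac)
    then have "((\<lambda>y. exp (z * of_real y) - (\<Sum>j<Suc m. (z * of_real y) ^ j / fact j)) has_vector_derivative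
        (z * exp (z * of_real y) - (\<Sum>j<Suc m. of_nat j * (z * of_real y) ^ (j - 1) * z / fact j))) (at y within S)"
      by (rule has_vector_derivative_real_field)
    \<comment> \<open>The term \<open>j = 0\<close>, with its truncated exponent
      \<open>j - 1\<close>, is killed by the factor \<open>of_nat j\<close>; shifting the index then
      lowers the order by one.\<close>
    moreover have "(\<Sum>j<Suc m. of_nat j * (z * of_real y) ^ (j - 1) * z / fact j)
        = z * (\<Sum>j<m. (z * of_real y) ^ j / fact j)"
    proof -
      have "of_nat (Suc i) * (z * of_real y) ^ (Suc i - 1) * z / fact (Suc i)
          = z * ((z * of_real y) ^ i / fact i)" for i
        by (simp add: divide_simps del: of_nat_Suc)
      then show ?thesis
        by (subst sum.lessThan_Suc_shift) (simp only: sum_distrib_left, simp)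
    qed
    moreover have "R l k = (\<lambda>y. exp (z * of_real y) - (\<Sum>j<l. (z * of_real y) ^ j / fact j))" for l
      by (simp add: fun_eq_iff R_def z_def cis_conv_exp mult.assoc)
    ultimately show ?thesis by (simp add: z_def[symmetric] right_diff_distrib)
  qed
  have I: "(dx_inv 1 ^^ Suc m) (\<lambda>y. \<Sum>k\<in>A. c k * cis (of_int k * y)) x
      = integral {0..x} (\<lambda>y. \<Sum>k\<in>A. c k / (\<i> * of_int k) ^ m * R m k y)"
  proof -
    have "(dx_inv 1 ^^ Suc m) P x = integral {0..x} ((dx_inv 1 ^^ m) P)" for P
      by (simp only: funpow.simps o_apply) (rule dx_inv_1)
    then show ?thesis
      by (simp only:, intro Henstock_Kurzweil_Integration.integral_cong) (simp add: Suc.IH R_def)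
  qed
  have "((\<lambda>y. \<Sum>k\<in>A. c k / (\<i> * of_int k) ^ m * R m k y) has_integral
      (\<Sum>k\<in>A. c k / (\<i> * of_int k) ^ Suc m * (R (Suc m) k x - R (Suc m) k 0))) {0..x}"
  proof (rule has_integral_sum[OF A(1)])
    fix k assume "k \<in> A"
    then have k: "\<i> * complex_of_int k \<noteq> 0" using A by auto
    have "((\<lambda>y. (\<i> * of_int k) * R m k y) has_integral (R (Suc m) k x - R (Suc m) k 0)) {0..x}"
      using Suc.prems R_deriv by (intro fundamental_theorem_of_calculus) auto
    then have "((\<lambda>y. c k / (\<i> * of_int k) ^ Suc m * ((\<i> * of_int k) * R m k y)) has_integral
        c k / (\<i> * of_int k) ^ Suc m * (R (Suc m) k x - R (Suc m) k 0)) {0..x}"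
      by (rule has_integral_mult_right)
    moreover have "c k / (\<i> * of_int k) ^ Suc m * ((\<i> * of_int k) * r) = c k / (\<i> * of_int k) ^ m * r" for r
      using k by (simp add: field_simps)
    ultimately show "((\<lambda>y. c k / (\<i> * of_int k) ^ m * R m k y) has_integral
        c k / (\<i> * of_int k) ^ Suc m * (R (Suc m) k x - R (Suc m) k 0)) {0..x}"
      by simp
  qed
  moreover have "R (Suc m) k 0 = 0" for k
    by (simp add: R_def sum.lessThan_Suc_shift del: sum.lessThan_Suc)
  ultimately have "(dx_inv 1 ^^ Suc m) (\<lambda>y. \<Sum>k\<in>A. c k * cis (of_int k * y)) x
      = (\<Sum>k\<in>A. c k / (\<i> * of_int k) ^ Suc m * R (Suc m) k x)"
    unfolding I by (intro integral_unique) simp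
  then show ?case unfolding R_def .
qed simp

text \<open>Bounded convergence. The bound and the integrability of the primitives are recorded too,
  so that the result can be iterated.\<close>

lemma dx_inv_tendsto:
  fixes \<phi> :: "nat \<Rightarrow> real \<Rightarrow> complex"
  assumes int: "\<And>n. \<phi> n integrable_on {0..L}" and bd: "\<And>n x. x \<in> {0..L} \<Longrightarrow> norm (\<phi> n x) \<le> B"
    and E: "negligible E" and lim: "\<And>x. x \<in> {0..L} - E \<Longrightarrow> (\<lambda>n. \<phi> n x) \<longlonglongrightarrow> \<psi> x"
    and x: "x \<in> {0..L}"
  shows "(\<lambda>n. dx_inv 1 (\<phi> n) x) \<longlonglongrightarrow> dx_inv 1 \<psi> x"
    and "norm (dx_inv 1 (\<phi> n) x) \<le> B * L"
    and "dx_inv 1 (\<phi> n) integrable_on {0..L}"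
proof -
  have int_x: "\<phi> n integrable_on {0..x}" for n
    using int[of n] x by (auto intro: integrable_on_subinterval)
  have "0 \<le> B" using order_trans[OF norm_ge_zero bd[OF x]] .
  \<comment> \<open>Setting the functions to 0 on \<open>E\<close> makes convergence hold at every
    point and leaves the integrals unchanged.\<close>
  define \<phi>' where "\<phi>' n y = (if y \<in> E then 0 else \<phi> n y)" for n y
  define \<psi>' where "\<psi>' y = (if y \<in> E then 0 else \<psi> y)" for y
  have "(\<lambda>n. integral {0..x} (\<phi>' n)) \<longlonglongrightarrow> integral {0..x} \<psi>'"
  proof (rule dominated_convergence(2))
    show "\<phi>' n integrable_on {0..x}" for n
      by (rule integrable_spike[OF int_x E]) (auto simp: \<phi>'_def)
    show "(\<lambda>_. B) integrable_on {0..x}" by (rule integrable_const_ivl)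
    show "norm (\<phi>' n y) \<le> B" if "y \<in> {0..x}" for n y
      using bd[of y] that x \<open>0 \<le> B\<close> by (auto simp: \<phi>'_def)
    show "(\<lambda>n. \<phi>' n y) \<longlonglongrightarrow> \<psi>' y" if "y \<in> {0..x}" for y
      using lim[of y] that x by (auto simp: \<phi>'_def \<psi>'_def)
  qed
  moreover have "integral {0..x} (\<phi>' n) = integral {0..x} (\<phi> n)" for n
    by (rule integral_spike[OF E]) (auto simp: \<phi>'_def)
  moreover have "integral {0..x} \<psi>' = integral {0..x} \<psi>"
    by (rule integral_spike[OF E]) (auto simp: \<psi>'_def)
  ultimately show "(\<lambda>n. dx_inv 1 (\<phi> n) x) \<longlonglongrightarrow> dx_inv 1 \<psi> x"
    by (simp add: dx_inv_1)
  have "norm (integral {0..x} (\<phi> n)) \<le> integral {0..x} (\<lambda>_. B)"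
    by (rule integral_norm_bound_integral[OF int_x]) (use bd x in auto)
  also have "\<dots> \<le> B * L"
    using x mult_left_mono[of x L B] \<open>0 \<le> B\<close> by (simp add: mult.commute)
  finally show "norm (dx_inv 1 (\<phi> n) x) \<le> B * L" by (simp add: dx_inv_1)
  show "dx_inv 1 (\<phi> n) integrable_on {0..L}"
    using indefinite_integral_continuous_1[OF int[of n]]
    by (intro integrable_continuous_real) (simp add: dx_inv_1[abs_def])
qed

text \<open>The induction carries convergence off \<open>E\<close> only; the last integration yields
  it at every point of the interval, hence \<open>m > 0\<close>.\<close>

lemma funpow_dx_inv_tendsto:
  fixes \<phi> :: "nat \<Rightarrow> real \<Rightarrow> complex"
  assumes int: "\<And>n. \<phi> n integrable_on {0..L}" and bd: "\<And>n x. x \<in> {0..L} \<Longrightarrow> norm (\<phi> n x) \<le> B"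
    and E: "negligible E" and lim: "\<And>x. x \<in> {0..L} - E \<Longrightarrow> (\<lambda>n. \<phi> n x) \<longlonglongrightarrow> \<psi> x"
    and x: "x \<in> {0..L}" and "m > 0"
  shows "(\<lambda>n. (dx_inv 1 ^^ m) (\<phi> n) x) \<longlonglongrightarrow> (dx_inv 1 ^^ m) \<psi> x"
proof -
  have *: "(\<forall>n. (dx_inv 1 ^^ l) (\<phi> n) integrable_on {0..L}) \<and>
      (\<forall>n. \<forall>x\<in>{0..L}. norm ((dx_inv 1 ^^ l) (\<phi> n) x) \<le> B * L ^ l) \<and>
      (\<forall>x\<in>{0..L} - E. (\<lambda>n. (dx_inv 1 ^^ l) (\<phi> n) x) \<longlonglongrightarrow> (dx_inv 1 ^^ l) \<psi> x)" for l
  proof (induction l)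
    case (Suc l)
    show ?case
      using dx_inv_tendsto[of "\<lambda>n. (dx_inv 1 ^^ l) (\<phi> n)" L "B * L ^ l" E "(dx_inv 1 ^^ l) \<psi>"] Suc E x
      by (auto simp: mult_ac)
  qed (use int bd lim in auto)
  obtain l where l: "m = Suc l" using \<open>m > 0\<close> gr0_conv_Suc by blast
  show ?thesis
    using dx_inv_tendsto(1)[of "\<lambda>n. (dx_inv 1 ^^ l) (\<phi> n)" L "B * L ^ l" E "(dx_inv 1 ^^ l) \<psi>" x] *[of l] E x
    by (simp add: l)
qed

section \<open>Unordered and symmetric sums over the nonzero integers\<close>

lemma summable_on_inverse_square_int: "(\<lambda>k::int. 1 / (real_of_int k)\<^sup>2) summable_on (UNIV - {0})"
proof -
  have nat: "(\<lambda>n::nat. 1 / (real (Suc n))\<^sup>2) summable_on UNIV"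
    using inverse_squares_sums by (subst summable_on_UNIV_nonneg_real_iff) (auto simp: sums_iff add_ac)
  have 1: "(\<lambda>k::int. 1 / (real_of_int k)\<^sup>2) summable_on range (\<lambda>n. int (Suc n))"
    by (subst summable_on_reindex) (use nat in \<open>auto simp: o_def inj_on_def\<close>)
  have 2: "(\<lambda>k::int. 1 / (real_of_int k)\<^sup>2) summable_on range (\<lambda>n. - int (Suc n))"
    by (subst summable_on_reindex) (use nat in \<open>auto simp: o_def inj_on_def power2_eq_square algebra_simps\<close>)
  have "UNIV - {0} = range (\<lambda>n. int (Suc n)) \<union> range (\<lambda>n. - int (Suc n))"
  proof (intro equalityI subsetI)
    fix k :: int assume k: "k \<in> UNIV - {0}"
    show "k \<in> range (\<lambda>n. int (Suc n)) \<union> range (\<lambda>n. - int (Suc n))"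
    proof (cases "k > 0")
      case True
      then have "k = int (Suc (nat (k - 1)))" by simp
      then show ?thesis by blast
    next
      case False
      then have "k = - int (Suc (nat (- k - 1)))" using k by simp
      then show ?thesis by blast
    qed
  qed auto
  moreover have "range (\<lambda>n. int (Suc n)) \<inter> range (\<lambda>n. - int (Suc n)) = {}" by auto
  ultimately show ?thesis using summable_on_Un_disjoint[OF 1 2] by simp
qed

text \<open>The punctured symmetric intervals eventually contain every finite set of nonzero
  integers, so the limit along finite sets is also the limit along them.\<close>

lemma symmetric_sum_tendsto_infsum:
  fixes c :: "int \<Rightarrow> 'a::{topological_comm_monoid_add, t2_space}"
  assumes "c summable_on (UNIV - {0})"
  shows "(\<lambda>n. \<Sum>k\<in>{- int n..int n} - {0}. c k) \<longlonglongrightarrow> (\<Sum>\<^sub>\<infinity>k\<in>UNIV - {0}. c k)"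
proof -
  have "filterlim (\<lambda>n. {- int n..int n} - {0}) (finite_subsets_at_top (UNIV - {0::int})) sequentially"
    unfolding filterlim_finite_subsets_at_top
  proof (intro allI impI)
    fix X :: "int set" assume X: "finite X \<and> X \<subseteq> UNIV - {0}"
    \<comment> \<open>The sum of the \<open>\<bar>k\<bar>\<close> bounds each of them and makes
      sense for empty \<open>X\<close> as well.\<close>
    define n0 where "n0 = nat (\<Sum>k\<in>X. \<bar>k\<bar>)"
    have "\<bar>k\<bar> \<le> int n0" if "k \<in> X" for k
      using member_le_sum[of k X abs] X that by (simp add: n0_def)
    then have "finite ({- int n..int n} - {0}) \<and> X \<subseteq> {- int n..int n} - {0} \<and>
        {- int n..int n} - {0} \<subseteq> UNIV - {0}" if "n \<ge> n0" for n
      using X that by fastforce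
    then show "\<forall>\<^sub>F n in sequentially. finite ({- int n..int n} - {0}) \<and> X \<subseteq> {- int n..int n} - {0} \<and>
        {- int n..int n} - {0} \<subseteq> UNIV - {0}"
      unfolding eventually_sequentially by blast
  qed
  from filterlim_compose[OF infsum_tendsto[OF assms] this] show ?thesis .
qed

subsection \<open>The solution at rational times\<close>

context periodic_bv
begin

text \<open>Translation by \<open>s\<close> multiplies the coefficients by
  \<open>cis (- (k * s))\<close>, and mean zero removes mode 0. The partial sums are uniformly
  bounded and converge off the countable, hence negligible, set of discontinuities, so they can be
  integrated termwise.\<close>

lemma iterated_fourier_sum_tendsto:
  assumes mean: "fourier_coeff F 0 = 0" and x: "x \<in> {0..2*pi}" and "N > 0"
  shows "(\<lambda>n. \<Sum>k\<in>{- int n..int n} - {0}. fourier_coeff F k * cis (- (of_int k * s)) / (\<i> * of_int k) ^ N *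
        (cis (of_int k * x) - (\<Sum>j<N. (\<i> * of_int k * of_real x) ^ j / fact j)))
      \<longlonglongrightarrow> (dx_inv 1 ^^ N) (\<lambda>y. F (y - s)) x"
proof -
  define A where "A n = {- int n..int n} - {0}" for n
  have eq: "(\<lambda>y. \<Sum>k\<in>A n. (fourier_coeff F k * cis (- (of_int k * s))) * cis (of_int k * y))
      = (\<lambda>y. fourier_sum F n (y - s))" for n
    unfolding A_def fourier_sum_def
    by (subst sum.remove[of "{- int n..int n}" 0])
      (auto simp: mean cis_mult algebra_simps)
  interpret S: periodic_bv "\<lambda>y. F (y - s)" "\<lambda>y. W (y - s)" by (rule translate)
  have "(\<lambda>n. (dx_inv 1 ^^ N) (\<lambda>y. fourier_sum F n (y - s)) x) \<longlonglongrightarrow> (dx_inv 1 ^^ N) (\<lambda>y. F (y - s)) x"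
  proof (rule funpow_dx_inv_tendsto)
    show "(\<lambda>y. fourier_sum F n (y - s)) integrable_on {0..2*pi}" for n
      unfolding fourier_sum_def by (intro integrable_continuous_real continuous_intros)
    show "norm (fourier_sum F n (y - s)) \<le> bound + (W (4 * pi) - W 0) / 2" for n y
      by (rule norm_fourier_sum_le)
    show "negligible {y. \<not> isCont (\<lambda>y. F (y - s)) y}"
      unfolding negligible_iff_null_sets
      by (rule null_sets_completionI[OF countable_imp_null_set_lborel[OF S.countable_discont]])
    show "(\<lambda>n. fourier_sum F n (y - s)) \<longlonglongrightarrow> F (y - s)"
      if "y \<in> {0..2*pi} - {y. \<not> isCont (\<lambda>y. F (y - s)) y}" for y
    proof (rule fourier_sum_tendsto, rule mean_value_at_if_isCont)
      have "isCont ((\<lambda>y. F (y - s)) \<circ> (\<lambda>z. z + s)) (y - s)"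
        using that by (intro continuous_at_compose) (auto intro!: continuous_intros)
      then show "isCont F (y - s)" by (simp add: o_def)
    qed
  qed (use x \<open>N > 0\<close> in auto)
  moreover have "(dx_inv 1 ^^ N) (\<lambda>y. fourier_sum F n (y - s)) x
      = (\<Sum>k\<in>A n. fourier_coeff F k * cis (- (of_int k * s)) / (\<i> * of_int k) ^ N *
        (cis (of_int k * x) - (\<Sum>j<N. (\<i> * of_int k * of_real x) ^ j / fact j)))" for n
    unfolding eq[symmetric] by (rule funpow_dx_inv_trig) (use x in \<open>auto simp: A_def\<close>)
  ultimately show ?thesis by (simp only: A_def)
qed

text \<open>The coefficients are O(1/k) and \<open>m \<ge> 1\<close> gives another factor 1/k, so
  the terms are O(1/k^2). This covers every \<open>C\<^sub>j\<close>, including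
  \<open>j = N - 1\<close> with its single power of \<open>k\<close>.\<close>

lemma summable_fourier_coeff_mult:
  assumes \<sigma>: "\<And>k. norm (\<sigma> k) \<le> 1" and "m \<ge> 1"
  shows "(\<lambda>k. fourier_coeff F k * \<sigma> k / of_int k ^ m) summable_on (UNIV - {0})"
proof (rule Infinite_Sum.abs_summable_summable, rule Infinite_Sum.abs_summable_on_comparison_test)
  define C where "C = (W (4 * pi) - W 0) / 4"
  have "(\<lambda>k. C * (1 / (real_of_int k)\<^sup>2)) summable_on (UNIV - {0})"
    by (intro summable_on_cmult_right summable_on_inverse_square_int)
  then show "(\<lambda>k. norm (C * (1 / (real_of_int k)\<^sup>2))) summable_on (UNIV - {0})"
    by (rule summable_on_iff_abs_summable_on_real[THEN iffD1])
  fix k :: int assume "k \<in> UNIV - {0}"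
  then have k: "1 \<le> \<bar>real_of_int k\<bar>" "k \<noteq> 0" by auto
  have c: "norm (fourier_coeff F k) \<le> C / \<bar>of_int k\<bar>"
    unfolding C_def by (rule norm_fourier_coeff_le[OF k(2)])
  have "norm (fourier_coeff F k * \<sigma> k / of_int k ^ m) \<le> norm (fourier_coeff F k) / \<bar>of_int k\<bar> ^ m"
    using mult_left_mono[OF \<sigma>[of k], of "norm (fourier_coeff F k)"]
    by (simp add: norm_divide norm_mult norm_power divide_right_mono)
  also have "\<dots> \<le> norm (fourier_coeff F k) / \<bar>of_int k\<bar> ^ 1"
    using k \<open>m \<ge> 1\<close> by (intro divide_left_mono power_increasing mult_pos_pos) auto
  also have "\<dots> \<le> (C / \<bar>of_int k\<bar>) / \<bar>of_int k\<bar> ^ 1"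
    by (intro divide_right_mono c) auto
  also have "\<dots> = C * (1 / (real_of_int k)\<^sup>2)" by (simp add: power2_eq_square)
  also have "\<dots> \<le> norm (C * (1 / (real_of_int k)\<^sup>2))" by (simp only: real_norm_def abs_ge_self)
  finally show "norm (fourier_coeff F k * \<sigma> k / of_int k ^ m) \<le> norm (C * (1 / (real_of_int k)\<^sup>2))" .
qed

text \<open>\<open>cis (k * x)\<close> is split into its Taylor polynomial of degree below
  \<open>N\<close> and the remainder \<open>R k\<close>. In the remainder part
  \<open>\<sigma>\<close> is expanded into translations and \<open>\<i> ^ N\<close> cancels the
  powers of \<open>\<i>\<close> left by integration; in the polynomial part
  \<open>k ^ j / k ^ N\<close> becomes \<open>1 / k ^ (N - j)\<close>.\<close>

lemma multiplier_series_tendsto: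
  assumes mean: "fourier_coeff F 0 = 0" and x: "x \<in> {0..2*pi}" and "N \<ge> 1"
    and \<sigma>: "\<And>k. norm (\<sigma> k) \<le> 1" and b: "\<And>k. \<sigma> k = (\<Sum>j\<in>J. b j * cis (- (of_int k * s j)))"
  shows "(\<lambda>n. \<Sum>k\<in>{- int n..int n} - {0}. fourier_coeff F k * \<sigma> k / of_int k ^ N * cis (of_int k * x))
    \<longlonglongrightarrow> \<i> ^ N * (\<Sum>j\<in>J. b j * (dx_inv 1 ^^ N) (\<lambda>y. F (y - s j)) x) +
      (\<Sum>j<N. \<i> ^ j / fact j * (\<Sum>\<^sub>\<infinity>k\<in>UNIV - {0}. fourier_coeff F k * \<sigma> k / of_int k ^ (N - j)) * of_real x ^ j)"
proof -
  define A where "A n = {- int n..int n} - {0}" for n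
  define R where "R k = cis (of_int k * x) - (\<Sum>j<N. (\<i> * of_int k * of_real x) ^ j / fact j)" for k
  define T where "T j = (\<Sum>\<^sub>\<infinity>k\<in>UNIV - {0}. fourier_coeff F k * \<sigma> k / of_int k ^ (N - j))" for j
  have 1: "(\<lambda>n. \<i> ^ N * (\<Sum>j\<in>J. b j * (\<Sum>k\<in>A n. fourier_coeff F k * cis (- (of_int k * s j)) / (\<i> * of_int k) ^ N * R k)))
      \<longlonglongrightarrow> \<i> ^ N * (\<Sum>j\<in>J. b j * (dx_inv 1 ^^ N) (\<lambda>y. F (y - s j)) x)"
    unfolding A_def R_def using \<open>N \<ge> 1\<close>
    by (intro tendsto_mult tendsto_const tendsto_sum iterated_fourier_sum_tendsto[OF mean x]) auto
  have 2: "(\<lambda>n. \<Sum>j<N. \<i> ^ j / fact j * (\<Sum>k\<in>A n. fourier_coeff F k * \<sigma> k / of_int k ^ (N - j)) * of_real x ^ j)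
      \<longlonglongrightarrow> (\<Sum>j<N. \<i> ^ j / fact j * T j * of_real x ^ j)"
    unfolding A_def T_def
    by (intro tendsto_sum tendsto_mult tendsto_const symmetric_sum_tendsto_infsum
        summable_fourier_coeff_mult \<sigma>) auto
  have eq: "\<i> ^ N * (\<Sum>j\<in>J. b j * (\<Sum>k\<in>A n. fourier_coeff F k * cis (- (of_int k * s j)) / (\<i> * of_int k) ^ N * R k))
      + (\<Sum>j<N. \<i> ^ j / fact j * (\<Sum>k\<in>A n. fourier_coeff F k * \<sigma> k / of_int k ^ (N - j)) * of_real x ^ j)
      = (\<Sum>k\<in>A n. fourier_coeff F k * \<sigma> k / of_int k ^ N * cis (of_int k * x))" for n
  proof -
    have "\<i> ^ N * (\<Sum>j\<in>J. b j * (\<Sum>k\<in>A n. fourier_coeff F k * cis (- (of_int k * s j)) / (\<i> * of_int k) ^ N * R k))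
        = (\<Sum>j\<in>J. \<Sum>k\<in>A n. fourier_coeff F k * (b j * cis (- (of_int k * s j))) / of_int k ^ N * R k)"
      unfolding sum_distrib_left
      by (intro sum.cong refl) (simp add: power_mult_distrib)
    also have "\<dots> = (\<Sum>k\<in>A n. fourier_coeff F k * \<sigma> k / of_int k ^ N * R k)"
      by (subst sum.swap) (simp add: b sum_distrib_left sum_distrib_right sum_divide_distrib)
    finally have l: "\<i> ^ N * (\<Sum>j\<in>J. b j * (\<Sum>k\<in>A n. fourier_coeff F k * cis (- (of_int k * s j)) / (\<i> * of_int k) ^ N * R k))
        = (\<Sum>k\<in>A n. fourier_coeff F k * \<sigma> k / of_int k ^ N * R k)" .
    have "(\<Sum>j<N. \<i> ^ j / fact j * (\<Sum>k\<in>A n. fourier_coeff F k * \<sigma> k / of_int k ^ (N - j)) * of_real x ^ j)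
        = (\<Sum>j<N. \<Sum>k\<in>A n. fourier_coeff F k * \<sigma> k / of_int k ^ N * ((\<i> * of_int k * of_real x) ^ j / fact j))"
      unfolding sum_distrib_left sum_distrib_right
    proof (intro sum.cong refl)
      fix j k assume "j \<in> {..<N}" "k \<in> A n"
      then have "k \<noteq> 0" "complex_of_int k ^ N = of_int k ^ (N - j) * of_int k ^ j"
        by (auto simp: A_def power_add[symmetric])
      then show "\<i> ^ j / fact j * (fourier_coeff F k * \<sigma> k / of_int k ^ (N - j)) * of_real x ^ j
        = fourier_coeff F k * \<sigma> k / of_int k ^ N * ((\<i> * of_int k * of_real x) ^ j / fact j)"
        by (simp add: power_mult_distrib mult_ac)
    qed
    also have "\<dots> = (\<Sum>k\<in>A n. fourier_coeff F k * \<sigma> k / of_int k ^ N * (\<Sum>j<N. (\<i> * of_int k * of_real x) ^ j / fact j))"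
      by (subst sum.swap) (simp only: sum_distrib_left)
    finally show ?thesis
      unfolding l by (simp add: sum.distrib[symmetric] R_def algebra_simps)
  qed
  from tendsto_add[OF 1 2] show ?thesis
    unfolding eq T_def by (simp only: A_def)
qed

end

text \<open>Stated for a general function of period \<open>2 * pi\<close> so as to serve both cosine
  and sine. The discrete frequencies \<open>2 * pi * j / (2 * q)\<close> are the translations by
  \<open>pi * j / q\<close>.\<close>

lemma rational_time_multiplier:
  fixes \<theta> :: "real \<Rightarrow> real" and N p q :: nat
  assumes "q > 0" and per: "\<And>r (u::int). \<theta> (r + 2 * pi * of_int u) = \<theta> r"
  obtains a :: "nat \<Rightarrow> complex"
  where "\<And>k. of_real (\<theta> (of_int k ^ N * (pi * real p / real q)))
    = (\<Sum>j = 0..2 * q - 1. a j * cis (- (of_int k * (pi * real j / real q))))"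
proof -
  have c_per: "complex_of_real (\<theta> (of_int (k + int (2 * q)) ^ N * (pi * real p / real q)))
      = of_real (\<theta> (of_int k ^ N * (pi * real p / real q)))" for k
  proof -
    obtain u :: int where "of_int (k + int (2 * q)) ^ N * (pi * real p / real q)
        = of_int k ^ N * (pi * real p / real q) + 2 * pi * of_int u"
      using power_phase_periodic[OF \<open>q > 0\<close>] .
    then show ?thesis by (simp only: per)
  qed
  obtain a :: "nat \<Rightarrow> complex" where a: "\<And>k. of_real (\<theta> (of_int k ^ N * (pi * real p / real q)))
    = (\<Sum>j<2 * q. a j * cis (- (of_int k * (2 * pi * real j / real (2 * q)))))"
    by (rule discrete_fourier[of "2 * q" "\<lambda>k. of_real (\<theta> (of_int k ^ N * (pi * real p / real q)))", OF _ c_per])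
      (use \<open>q > 0\<close> in simp, blast)
  have "{0..2 * q - 1} = {..<2 * q}" using \<open>q > 0\<close> by auto
  moreover have "2 * pi * real j / real (2 * q) = pi * real j / real q" for j by simp
  ultimately show ?thesis using a by (intro that[of a]) (simp only:)
qed

theorem theorem3p1:
  fixes N p q :: nat
  assumes "N \<ge> 2" and "p > 0" and "q > 0" and "coprime p q"
  shows "\<exists>a b :: nat \<Rightarrow> complex. \<forall>f g :: real \<Rightarrow> complex.
           bounded_variation_on 0 (2*pi) f \<and> bounded_variation_on 0 (2*pi) g \<and>
           integral {0..2*pi} g = 0 \<longrightarrow>
           (let t = pi * real p / real q;
                u = solution_partial_sum N f g t;
                rhs = (\<lambda>x::real.
                  (\<Sum>j = 0..2*q - 1. a j * periodic_ext f (x - pi * real j / real q)) +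
                  \<i> ^ N * (\<Sum>j = 0..2*q - 1. b j * G_shift N g (pi * real j / real q) x) +
                  (\<Sum>j = 0..N - 1. poly_coeff N g t j * of_real x ^ j))
            in countable {x \<in> {0..2*pi}. \<not> u x \<longlonglongrightarrow> rhs x} \<and>
               (\<forall>x\<in>{0..2*pi}.
                 (\<forall>j\<le>2*q - 1. mean_value_at (periodic_ext f) (x - pi * real j / real q)) \<longrightarrow>
                 u x \<longlonglongrightarrow> rhs x))"
proof -
  define t where "t = pi * real p / real q"
  define s where "s j = pi * real j / real q" for j
  define J where "J = {0..2 * q - 1}"
  have per: "cos (r + 2 * pi * of_int u) = cos r" "sin (r + 2 * pi * of_int u) = sin r" for r and u :: int
    by (simp_all add: cos_add sin_add)
  \<comment> \<open>\<open>a\<close> and \<open>b\<close> are fixed before \<open>f\<close> and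
    \<open>g\<close>, since one choice has to serve all initial data.\<close>
  obtain a where a: "\<And>k. of_real (cos (of_int k ^ N * t)) = (\<Sum>j\<in>J. a j * cis (- (of_int k * s j)))"
    using rational_time_multiplier[OF \<open>q > 0\<close> per(1), of N p] unfolding t_def s_def J_def by blast
  obtain b where b: "\<And>k. of_real (sin (of_int k ^ N * t)) = (\<Sum>j\<in>J. b j * cis (- (of_int k * s j)))"
    using rational_time_multiplier[OF \<open>q > 0\<close> per(2), of N p] unfolding t_def s_def J_def by blast
  have main: "countable {x \<in> {0..2*pi}. \<not> solution_partial_sum N f g t x \<longlonglongrightarrow>
        (\<Sum>j\<in>J. a j * periodic_ext f (x - s j)) + \<i> ^ N * (\<Sum>j\<in>J. b j * G_shift N g (s j) x) +
        (\<Sum>j = 0..N - 1. poly_coeff N g t j * of_real x ^ j)} \<and>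
      (\<forall>x\<in>{0..2*pi}. (\<forall>j\<le>2*q - 1. mean_value_at (periodic_ext f) (x - s j)) \<longrightarrow>
        solution_partial_sum N f g t x \<longlonglongrightarrow>
        (\<Sum>j\<in>J. a j * periodic_ext f (x - s j)) + \<i> ^ N * (\<Sum>j\<in>J. b j * G_shift N g (s j) x) +
        (\<Sum>j = 0..N - 1. poly_coeff N g t j * of_real x ^ j))"
    (is "countable {x \<in> _. \<not> _ x \<longlonglongrightarrow> ?rhs x} \<and> _")
    if f: "bounded_variation_on 0 (2*pi) f" and g: "bounded_variation_on 0 (2*pi) g"
      and mean: "integral {0..2*pi} g = 0" for f g
  proof -
    obtain Wf where "periodic_bv (periodic_ext f) Wf" using periodic_bv_periodic_ext[OF f] .
    then interpret f: periodic_bv "periodic_ext f" Wf .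
    obtain Wg where "periodic_bv (periodic_ext g) Wg" using periodic_bv_periodic_ext[OF g] .
    then interpret g: periodic_bv "periodic_ext g" Wg .
    have g0: "fourier_coeff (periodic_ext g) 0 = 0"
      unfolding fourier_coeff_periodic_ext using mean by (simp add: fourier_coeff_def)
    have conv: "solution_partial_sum N f g t x \<longlonglongrightarrow> ?rhs x"
      if x: "x \<in> {0..2*pi}" and mv: "\<forall>j\<in>J. mean_value_at (periodic_ext f) (x - s j)" for x
    proof -
      \<comment> \<open>Evaluating a Fourier sum at \<open>x - s j\<close> multiplies mode
        \<open>k\<close> by \<open>cis (- (k * s j))\<close>, so these combinations reproduce the
        cosine multiplier.\<close>
      have "(\<lambda>n. \<Sum>j\<in>J. a j * fourier_sum (periodic_ext f) n (x - s j))
          \<longlonglongrightarrow> (\<Sum>j\<in>J. a j * periodic_ext f (x - s j))"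
        using mv by (intro tendsto_sum tendsto_mult tendsto_const f.fourier_sum_tendsto) auto
      also have "(\<lambda>n. \<Sum>j\<in>J. a j * fourier_sum (periodic_ext f) n (x - s j))
          = (\<lambda>n. \<Sum>k\<in>{- int n..int n}. fourier_coeff f k * of_real (cos (of_int k ^ N * t)) * cis (of_int k * x))"
      proof
        fix n
        have "(\<Sum>j\<in>J. a j * fourier_sum (periodic_ext f) n (x - s j))
            = (\<Sum>k\<in>{- int n..int n}. \<Sum>j\<in>J. fourier_coeff f k * (a j * cis (- (of_int k * s j))) * cis (of_int k * x))"
          unfolding fourier_sum_def sum_distrib_left fourier_coeff_periodic_ext
          by (subst sum.swap) (simp add: cis_mult algebra_simps)
        also have "\<dots> = (\<Sum>k\<in>{- int n..int n}. fourier_coeff f k * of_real (cos (of_int k ^ N * t)) * cis (of_int k * x))"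
          by (simp only: a sum_distrib_left[symmetric] sum_distrib_right[symmetric])
        finally show "(\<Sum>j\<in>J. a j * fourier_sum (periodic_ext f) n (x - s j))
            = (\<Sum>k\<in>{- int n..int n}. fourier_coeff f k * of_real (cos (of_int k ^ N * t)) * cis (of_int k * x))" .
      qed
      finally have 1: "(\<lambda>n. \<Sum>k\<in>{- int n..int n}. fourier_coeff f k * of_real (cos (of_int k ^ N * t)) * cis (of_int k * x))
          \<longlonglongrightarrow> (\<Sum>j\<in>J. a j * periodic_ext f (x - s j))" .
      \<comment> \<open>The \<open>g\<close>-part converges at every \<open>x\<close> of the period,
        as integration smooths the jumps of \<open>g\<close>; exceptional points come from
        \<open>f\<close> alone.\<close>
      have "(\<lambda>n. \<Sum>k\<in>{- int n..int n} - {0}. fourier_coeff (periodic_ext g) k *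
            of_real (sin (of_int k ^ N * t)) / of_int k ^ N * cis (of_int k * x))
        \<longlonglongrightarrow> \<i> ^ N * (\<Sum>j\<in>J. b j * (dx_inv 1 ^^ N) (\<lambda>y. periodic_ext g (y - s j)) x) +
          (\<Sum>j<N. \<i> ^ j / fact j * (\<Sum>\<^sub>\<infinity>k\<in>UNIV - {0}. fourier_coeff (periodic_ext g) k *
            of_real (sin (of_int k ^ N * t)) / of_int k ^ (N - j)) * of_real x ^ j)"
        using \<open>N \<ge> 2\<close> by (intro g.multiplier_series_tendsto[OF g0 x] b) auto
      also have "{..<N} = {0..N - 1}" using \<open>N \<ge> 2\<close> by auto
      finally have 2: "(\<lambda>n. \<Sum>k\<in>{- int n..int n} - {0}. fourier_coeff g k *
            of_real (sin (of_int k ^ N * t)) / of_int k ^ N * cis (of_int k * x))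
        \<longlonglongrightarrow> \<i> ^ N * (\<Sum>j\<in>J. b j * G_shift N g (s j) x) +
          (\<Sum>j = 0..N - 1. poly_coeff N g t j * of_real x ^ j)"
        by (simp only: fourier_coeff_periodic_ext G_shift_def poly_coeff_def)
      have eq: "solution_partial_sum N f g t x n
          = (\<Sum>k\<in>{- int n..int n}. fourier_coeff f k * of_real (cos (of_int k ^ N * t)) * cis (of_int k * x))
          + (\<Sum>k\<in>{- int n..int n} - {0}. fourier_coeff g k *
              of_real (sin (of_int k ^ N * t)) / of_int k ^ N * cis (of_int k * x))" for n
      proof -
        have "(\<Sum>k\<in>{- int n..int n} - {0}. fourier_coeff g k *
              of_real (sin (of_int k ^ N * t)) / of_int k ^ N * cis (of_int k * x))
            = (\<Sum>k\<in>{- int n..int n}. (if k = 0 then 0 else fourier_coeff g k *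
              of_real (sin (of_int k ^ N * t)) / of_int k ^ N) * cis (of_int k * x))"
          by (rule sum.mono_neutral_cong_left) auto
        moreover have "exp (\<i> * of_int k * of_real x) = cis (of_int k * x)" for k
          by (simp add: cis_conv_exp mult.assoc)
        ultimately show ?thesis
          by (simp add: solution_partial_sum_def solution_mode_def distrib_right sum.distrib)
      qed
      from tendsto_add[OF 1 2] show ?thesis
        unfolding eq[abs_def] by (simp only: add.assoc)
    qed
    \<comment> \<open>Convergence can fail at \<open>x\<close> only if some \<open>x - s j\<close>
      is a discontinuity of the extension of \<open>f\<close>, which leaves finitely many translates
      of a countable set.\<close>
    have "countable (\<Union>j\<in>J. (\<lambda>y. y + s j) ` {y. \<not> isCont (periodic_ext f) y})"
      by (intro countable_UN countable_image f.countable_discont) (simp add: J_def)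
    moreover have "{x \<in> {0..2*pi}. \<not> solution_partial_sum N f g t x \<longlonglongrightarrow> ?rhs x}
        \<subseteq> (\<Union>j\<in>J. (\<lambda>y. y + s j) ` {y. \<not> isCont (periodic_ext f) y})"
    proof
      fix x assume x: "x \<in> {x \<in> {0..2*pi}. \<not> solution_partial_sum N f g t x \<longlonglongrightarrow> ?rhs x}"
      then obtain j where j: "j \<in> J" "\<not> mean_value_at (periodic_ext f) (x - s j)"
        using conv by blast
      then have "\<not> isCont (periodic_ext f) (x - s j)" using mean_value_at_if_isCont by blast
      then have "x \<in> (\<lambda>y. y + s j) ` {y. \<not> isCont (periodic_ext f) y}"
        by (intro image_eqI[of _ _ "x - s j"]) auto
      with j show "x \<in> (\<Union>j\<in>J. (\<lambda>y. y + s j) ` {y. \<not> isCont (periodic_ext f) y})" by blast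
    qed
    ultimately have "countable {x \<in> {0..2*pi}. \<not> solution_partial_sum N f g t x \<longlonglongrightarrow> ?rhs x}"
      by (rule countable_subset[rotated])
    moreover have "j \<le> 2 * q - 1" if "j \<in> J" for j using that by (simp add: J_def)
    ultimately show ?thesis using conv by blast
  qed
  show ?thesis
    unfolding Let_def
    by (rule exI[of _ a], rule exI[of _ b], intro allI impI, elim conjE, rule main[unfolded t_def s_def J_def])
qed

end
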